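(* Let $D\subset\mathbb{C}$ be a simply connected domain (not necessarily bounded) and let $A\ge1$. If $D$ is an $A$-John domain, then for every weak tangent $Y$ of $\partial D$, every $D$-component of $\mathbb{C}\setminus Y$ is an $A$-John domain (with the same constant $A$).
   Context: $\ell(\gamma)$ denotes the length of a curve $\gamma$ (a continuous map from a compact interval). John domains: let $D\subset\mathbb{C}$ be a domain (possibly unbounded) and $A\ge 1$. $D$ is an $A$-John domain if for every pair of distinct points $a,b\in D$ there is a curve $\gamma\colon[0,1]\to D$ with $\gamma(0)=a$, $\gamma(1)=b$ and $\min\{\ell(\gamma|_{[0,t]}),\ell(\gamma|_{[t,1]})\}\le A\,\mathrm{dist}(\gamma(t),\partial D)$ for all $t\in[0,1]$. Local Hausdorff convergence: $B(a,R)$ is the open ball and $N_\varepsilon(E)$ is the open $\varepsilon$-neighborhood of $E$. Closed sets $Y_n\subset\mathbb{C}$ converge to a closed set $Y\subset\mathbb{C}$ in the local Hausdorff sense if for each $z_0\in\mathbb{C}$ and all $R,\varepsilon>0$ there is $N\in\mathbb{N}$ such that for all $n\ge N$: $Y_n\cap B(z_0,R-\varepsilon)\subset N_\varepsilon(Y\cap B(z_0,R))$ and $Y\cap B(z_0,R-\varepsilon)\subset N_\varepsilon(Y_n\cap B(z_0,R))$. Weak tangents: a closed set $Y\subset\mathbb{C}$ is a weak tangent of a closed set $X\subset\mathbb{C}$ if there are points $p_n\in X$ and scales $\lambda_n>0$ with $\lambda_n\to0$ such that the sets $X_n=(X-p_n)/\lambda_n$ converge to $Y$ in the local Hausdorff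 sense. $D$-components: let $Y$ be a weak tangent of $\partial D$ arising from sequences $p_n\in\partial D$, $\lambda_n\to0$, and set $D_n=(D-p_n)/\lambda_n$. A connected component $U$ of $\mathbb{C}\setminus Y$ is a $D$-component if there exists $z\in U$ such that $z\in D_n$ for infinitely many $n$. The weak tangent and its $D$-components depend on the sequences $p_n,\lambda_n$. *)

theory Defs
  imports "HOL-Analysis.Analysis"
begin

text \<open>Length of the restriction of \<open>g\<close> to \<open>[a,b]\<close>, as the supremum over all
  subdivisions \<open>a = t 0 \<le> t 1 \<le> \<dots> \<le> t n = b\<close>; it is \<open>\<infinity>\<close> for non-rectifiable curves.\<close>

definition curve_length :: "(real \<Rightarrow> complex) \<Rightarrow> real \<Rightarrow> real \<Rightarrow> ennreal" where
  "curve_length g a b =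
     (SUP (n, t) \<in> {(n :: nat, t :: nat \<Rightarrow> real). t 0 = a \<and> t n = b \<and> (\<forall>i<n. t i \<le> t (Suc i))}.
        ennreal (\<Sum>i<n. dist (g (t i)) (g (t (Suc i)))))"

text \<open>Unlike \<^const>\<open>infdist\<close> and \<^const>\<open>setdist\<close>, which are \<open>0\<close> for the empty set, this
  distance is \<open>\<infinity>\<close> there, so that the John condition is void for the whole plane.\<close>

definition dist_to :: "complex \<Rightarrow> complex set \<Rightarrow> ennreal" where
  "dist_to z E = (INF w\<in>E. ennreal (dist z w))"

definition domain :: "complex set \<Rightarrow> bool" where
  "domain D \<longleftrightarrow> open D \<and> connected D \<and> D \<noteq> {}"

definition John_domain :: "real \<Rightarrow> complex set \<Rightarrow> bool" where
  "John_domain A D \<longleftrightarrow> 1 \<le> A \<and> domain D \<and>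
     (\<forall>a\<in>D. \<forall>b\<in>D. a \<noteq> b \<longrightarrow>
        (\<exists>g. path g \<and> path_image g \<subseteq> D \<and> pathstart g = a \<and> pathfinish g = b \<and>
             (\<forall>t\<in>{0..1}. min (curve_length g 0 t) (curve_length g t 1)
                            \<le> ennreal A * dist_to (g t) (frontier D))))"

definition nbhd :: "real \<Rightarrow> complex set \<Rightarrow> complex set" where
  "nbhd \<epsilon> E = (\<Union>w\<in>E. ball w \<epsilon>)"

definition local_Hausdorff_conv :: "(nat \<Rightarrow> complex set) \<Rightarrow> complex set \<Rightarrow> bool" where
  "local_Hausdorff_conv Yn Y \<longleftrightarrow>
     (\<forall>n. closed (Yn n)) \<and> closed Y \<and>
     (\<forall>z0. \<forall>R>0. \<forall>\<epsilon>>0. \<exists>N. \<forall>n\<ge>N.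
        Yn n \<inter> ball z0 (R - \<epsilon>) \<subseteq> nbhd \<epsilon> (Y \<inter> ball z0 R) \<and>
        Y \<inter> ball z0 (R - \<epsilon>) \<subseteq> nbhd \<epsilon> (Yn n \<inter> ball z0 R))"

definition rescale :: "complex \<Rightarrow> real \<Rightarrow> complex set \<Rightarrow> complex set" where
  "rescale p l X = (\<lambda>z. (z - p) / of_real l) ` X"

definition weak_tangent_along ::
  "complex set \<Rightarrow> (nat \<Rightarrow> complex) \<Rightarrow> (nat \<Rightarrow> real) \<Rightarrow> complex set \<Rightarrow> bool" where
  "weak_tangent_along X p l Y \<longleftrightarrow>
     closed X \<and> closed Y \<and> (\<forall>n. p n \<in> X) \<and> (\<forall>n. 0 < l n) \<and> l \<longlonglongrightarrow> 0 \<and>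
     local_Hausdorff_conv (\<lambda>n. rescale (p n) (l n) X) Y"

definition D_component ::
  "complex set \<Rightarrow> (nat \<Rightarrow> complex) \<Rightarrow> (nat \<Rightarrow> real) \<Rightarrow> complex set \<Rightarrow> complex set \<Rightarrow> bool" where
  "D_component D p l Y U \<longleftrightarrow>
     U \<in> components (- Y) \<and> (\<exists>z\<in>U. \<exists>\<^sub>\<infinity>n. z \<in> rescale (p n) (l n) D)"

end

theory Submission
  imports Defs "HOL-Complex_Analysis.Complex_Analysis"
begin

text \<open>A domain is \<open>A\<close>-John iff any two of its points \<open>a\<close>, \<open>b\<close> are the tips of carrots with a common end point,
  where a carrot from \<open>a\<close> is a 1-Lipschitz curve \<open>g\<close> with \<open>t \<le> A dist(g t, \<partial>D)\<close> for all \<open>t\<close>. By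
  Arzela--Ascoli, carrots in the rescaled domains \<open>D\<^sub>n\<close> converge to carrots in \<open>U\<close> as long as their
  lengths stay bounded. The difficulty is that the common end point may escape to infinity.

  Suppose that the carrots in \<open>U\<close> from \<open>a\<close> and those from \<open>b\<close> never meet, and let \<open>A > 1\<close>. Join \<open>a\<close> to \<open>b\<close> by
  a compact connected set \<open>K\<close> in \<open>U\<close>. Since \<open>D\<^sub>n\<close> is simply connected, it contains the region enclosed by \<open>K\<close>
  and the two carrots in \<open>D\<^sub>n\<close>. The segment from a point \<open>z\<close> of that region to its nearest boundary point crosses
  one of the two carrots, and then \<open>z\<close> itself is the end point of a carrot from \<open>a\<close> or from \<open>b\<close>, or
  it crosses \<open>K\<close>, and then the distance of \<open>z\<close> to the boundary is almost \<open>\<bar>z\<bar>\<close>. Far points of the latter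
  kind lie near directions \<open>e\<close> of half-planes contained in \<open>U\<close>, and a carrot that reaches such a direction
  can be continued straight to infinity. As \<open>A > 1\<close>, two carrots escaping in nearly the same direction
  can be made to meet; hence these directions split into two separated groups, which yields a
  separation of the region on a large circle and contradicts the absence of holes in the region. For
  \<open>A = 1\<close> the domains are convex, and the limit is handled directly.\<close>

section \<open>Topology of the plane\<close>

text \<open>The values are integer multiples of 2 pi i, hence at least 2 pi apart. This lets a
  logarithm be followed along a connected set that need not be a path.\<close>

lemma exp_eq_1_constant_on:
  fixes f :: "'a::topological_space \<Rightarrow> complex"
  assumes "connected S" "continuous_on S f" "\<And>z. z \<in> S \<Longrightarrow> exp (f z) = 1"
    and "x \<in> S" "y \<in> S"
  shows "f x = f y"
proof -
  have "f constant_on S"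
  proof (rule continuous_discrete_range_constant[OF assms(1,2)])
    fix z assume "z \<in> S"
    show "\<exists>e>0. \<forall>w. w \<in> S \<and> f w \<noteq> f z \<longrightarrow> e \<le> norm (f w - f z)"
    proof (intro exI[of _ "2*pi"] conjI allI impI)
      fix w assume w: "w \<in> S \<and> f w \<noteq> f z"
      then have "exp (f w) = exp (f z)" using assms(3) \<open>z \<in> S\<close> by auto
      then obtain n :: int where n: "f w = f z + (of_int (2*n) * pi) * \<i>"
        by (auto simp: exp_eq)
      have "n \<noteq> 0" using n w by auto
      then have "1 \<le> \<bar>real_of_int n\<bar>" by linarith
      then have "2*pi*1 \<le> 2*pi*\<bar>real_of_int n\<bar>" by (intro mult_left_mono) auto
      also have "\<dots> = norm (f w - f z)" by (simp add: n norm_mult)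
      finally show "2*pi \<le> norm (f w - f z)" by simp
    qed simp
  qed
  then show ?thesis using assms(4,5) by (auto simp: constant_on_def)
qed

text \<open>Since \<open>H\<close> does not separate the plane, the map that is \<open>exp (2 \<pi> \<i> u)\<close> on \<open>cball 0 r\<close> and 1 outside,
  where \<open>u\<close> is 1 on the part of the circle in \<open>Oa\<close> and 0 on the part in \<open>Ob\<close>, has a continuous logarithm on \<open>H\<close>.
  Following it along \<open>Sa\<close>, \<open>Sb\<close> and \<open>T\<close> yields \<open>2 \<pi> \<i> = 0\<close>.\<close>

lemma no_crossing_separation:
  fixes H Sa Sb T :: "complex set"
  assumes H: "compact H" "connected (- H)" and sub: "Sa \<subseteq> H" "Sb \<subseteq> H" "T \<subseteq> H"
    and conn: "connected Sa" "connected Sb" "connected T"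
    and mem: "a \<in> Sa" "a \<in> T" "b \<in> Sb" "b \<in> T" "m \<in> Sa" "m \<in> Sb"
    and T: "T \<subseteq> ball 0 r" and m: "r < norm m"
    and op: "open Oa" "open Ob" "Oa \<inter> Ob = {}"
    and cover: "H \<inter> sphere 0 r \<subseteq> Oa \<union> Ob"
    and Sa: "Sa \<inter> sphere 0 r \<subseteq> Oa" and Sb: "Sb \<inter> sphere 0 r \<subseteq> Ob"
  shows False
proof -
  \<comment> \<open>Removing the other open set makes both parts closed, as Urysohn's lemma
    requires; \<open>cover\<close> makes them disjoint, and \<open>Oa \<inter> Ob = {}\<close> makes
    them exhaust \<open>H \<inter> sphere 0 r\<close>.\<close>
  define Fa where "Fa = H \<inter> sphere 0 r - Ob"
  define Fb where "Fb = H \<inter> sphere 0 r - Oa"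
  have "closed H" using H by (simp add: compact_imp_closed)
  have cl: "closed Fa" "closed Fb"
    unfolding Fa_def Fb_def using op \<open>closed H\<close> by (simp_all add: closed_Diff closed_Int)
  have disj: "Fa \<inter> Fb = {}" using cover unfolding Fa_def Fb_def by blast
  obtain u :: "complex \<Rightarrow> real" where u: "continuous_on UNIV u"
      "\<And>x. x \<in> Fa \<Longrightarrow> u x = 1" "\<And>x. x \<in> Fb \<Longrightarrow> u x = 0"
    using Urysohn[OF cl disj, of "1::real" 0] by metis
  define h where "h z = 2 * of_real pi * \<i> * of_real (u z)" for z
  have conth: "continuous_on S h" for S
    unfolding h_def by (intro continuous_intros continuous_on_subset[OF u(1)]) auto
  have h_cases: "z \<in> Sa \<Longrightarrow> h z = 2 * of_real pi * \<i>" "z \<in> Sb \<Longrightarrow> h z = 0" if "norm z = r" for z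
  proof -
    have "z \<in> Sa \<Longrightarrow> z \<in> Fa" "z \<in> Sb \<Longrightarrow> z \<in> Fb"
      using that sub Sa Sb op(3) unfolding Fa_def Fb_def by force+
    then show "z \<in> Sa \<Longrightarrow> h z = 2 * of_real pi * \<i>" "z \<in> Sb \<Longrightarrow> h z = 0"
      using u(2,3)[of z] by (auto simp: h_def)
  qed
  have exph: "exp (h z) = 1" if "z \<in> H" "norm z = r" for z
  proof -
    have "z \<in> Fa \<or> z \<in> Fb" using that cover op(3) unfolding Fa_def Fb_def by auto
    then show ?thesis using u(2,3)[of z] by (auto simp: h_def)
  qed
  have glue: "continuous_on S (\<lambda>z. if norm z \<le> r then f z else g z)"
    if "continuous_on S f" "continuous_on S g" "\<And>z. z \<in> S \<Longrightarrow> norm z = r \<Longrightarrow> f z = g z"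
    for S and f g :: "complex \<Rightarrow> complex"
    by (rule continuous_on_cases_le)
      (use that in \<open>auto intro: continuous_on_subset continuous_on_norm_id\<close>)
  have "continuous_on H (\<lambda>z. if norm z \<le> r then exp (h z) else 1)"
    by (rule glue) (auto intro!: continuous_intros conth simp: exph)
  moreover have "(\<lambda>z. if norm z \<le> r then exp (h z) else 1) \<in> H \<rightarrow> - {0}" by auto
  moreover have "Borsukian H" using H by (simp add: Borsukian_separation_compact)
  ultimately have "\<exists>g. continuous_on H g \<and> (\<forall>z\<in>H. (if norm z \<le> r then exp (h z) else 1) = exp (g z))"
    unfolding Borsukian_continuous_logarithm by blast
  then obtain g where g: "continuous_on H g"
      and g_exp: "\<And>z. z \<in> H \<Longrightarrow> (if norm z \<le> r then exp (h z) else 1) = exp (g z)"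
    by blast
  have g_sub: "continuous_on S g" if "S \<subseteq> H" for S using g that continuous_on_subset by blast
  have rT: "norm z < r" if "z \<in> T" for z using that T by auto
  \<comment> \<open>Three constant functions are compared. As \<open>a\<close> and \<open>b\<close>
    lie inside the circle and \<open>m\<close> outside, they give
    \<open>g a - h a = g b - h b\<close>, \<open>g a - h a + 2 * of_real pi * \<i> = g m\<close> and
    \<open>g b - h b = g m\<close>. The summand in the second makes the two branches agree where
    \<open>Sa\<close> crosses the circle.\<close>
  have 1: "g a - h a = g b - h b"
  proof (rule exp_eq_1_constant_on[OF conn(3) _ _ mem(2,4)])
    show "continuous_on T (\<lambda>z. g z - h z)" by (intro continuous_intros g_sub conth sub)
    show "exp (g z - h z) = 1" if "z \<in> T" for z
      using g_exp[of z] rT[OF that] that sub by (auto simp: exp_diff)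
  qed
  have 2: "(if norm a \<le> r then g a - h a + 2 * of_real pi * \<i> else g a)
         = (if norm m \<le> r then g m - h m + 2 * of_real pi * \<i> else g m)"
  proof (rule exp_eq_1_constant_on[OF conn(1) _ _ mem(1,5)])
    show "continuous_on Sa (\<lambda>z. if norm z \<le> r then g z - h z + 2 * of_real pi * \<i> else g z)"
      by (rule glue) (auto intro!: continuous_intros g_sub conth sub simp: h_cases)
    show "exp (if norm z \<le> r then g z - h z + 2 * of_real pi * \<i> else g z) = 1" if "z \<in> Sa" for z
      using g_exp[of z] that sub by (auto simp: exp_diff exp_add split: if_splits)
  qed
  have 3: "(if norm b \<le> r then g b - h b else g b) = (if norm m \<le> r then g m - h m else g m)"
  proof (rule exp_eq_1_constant_on[OF conn(2) _ _ mem(3,6)])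
    show "continuous_on Sb (\<lambda>z. if norm z \<le> r then g z - h z else g z)"
      by (rule glue) (auto intro!: continuous_intros g_sub conth sub simp: h_cases)
    show "exp (if norm z \<le> r then g z - h z else g z) = 1" if "z \<in> Sb" for z
      using g_exp[of z] that sub by (auto simp: exp_diff split: if_splits)
  qed
  show False using 1 2 3 m rT[OF mem(2)] rT[OF mem(4)] by (auto split: if_splits)
qed

text \<open>Filling the holes of \<open>K\<close> leaves exactly its unbounded complementary
  component, which is connected.\<close>

lemma compact_filled_hull:
  fixes K :: "complex set"
  assumes "compact K"
  shows "compact (K \<union> inside K)" and "connected (- (K \<union> inside K))"
proof -
  have eq: "K \<union> inside K = - outside K"
    by (metis inside_outside sup_commute union_with_inside)
  show "compact (K \<union> inside K)"
    using assms bounded_inside[of K] open_outside[of K]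
    by (auto simp: compact_eq_bounded_closed eq[symmetric]) (simp add: closed_def eq)
  show "connected (- (K \<union> inside K))"
    using connected_outside[of K] assms by (simp add: eq compact_imp_bounded)
qed

text \<open>Simple connectivity puts the holes of \<open>K\<close> into \<open>D\<close>, so a
  nearest boundary point of \<open>P\<close> is outside the filled hull, and the segment towards it
  can leave the hull only through \<open>K\<close>.\<close>

lemma nearest_boundary_segment_meets:
  fixes D K :: "complex set"
  assumes D: "open D" "simply_connected D" and K: "K \<subseteq> D" "closed K"
    and P: "P \<in> K \<union> inside K" and ne: "frontier D \<noteq> {}"
  obtains w y where "w \<in> K" "y \<in> frontier D" "w \<in> closed_segment P y"
    "infdist P (frontier D) = dist P y"
proof -
  obtain y where y: "y \<in> frontier D" "infdist P (frontier D) = dist P y"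
    using infdist_attains_inf[OF frontier_closed ne] by blast
  have "y \<notin> D" using y(1) D(1) by (simp add: frontier_def interior_open)
  then have "y \<notin> inside K" using subset_simply_connected_imp_inside_subset[OF D(2,1) K(1)] by auto
  have "closed_segment P y \<inter> K \<noteq> {}"
  proof (cases "P \<in> K")
    case False
    then have "closed_segment P y \<inter> frontier (inside K) \<noteq> {}"
      using P \<open>y \<notin> inside K\<close> by (intro connected_Int_frontier) auto
    then show ?thesis using frontier_inside_subset[OF K(2)] by blast
  qed auto
  then show ?thesis using that y by blast
qed

section \<open>Rescaling of sets, frontiers and distances\<close>

lemma rescale_eq: "rescale p l X = (\<lambda>z. (1 / l) *\<^sub>R z) ` ((\<lambda>z. z - p) ` X)"
  by (auto simp: rescale_def image_image scaleR_conv_of_real divide_inverse mult.commute)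

lemma dist_rescale:
  fixes z w p :: complex
  shows "0 < l \<Longrightarrow> dist ((z - p) / of_real l) ((w - p) / of_real l) = dist z w / l"
  by (simp add: dist_norm norm_divide flip: diff_divide_distrib)

lemma homeomorphic_rescale: "0 < l \<Longrightarrow> X homeomorphic rescale p l X"
proof -
  assume l: "0 < l"
  have "homeomorphism X (rescale p l X) (\<lambda>z. (z - p) / of_real l) (\<lambda>z. z * of_real l + p)"
    using l by (auto simp: homeomorphism_def rescale_def image_image intro!: continuous_intros)
  then show ?thesis by (auto simp: homeomorphic_def)
qed

lemma closure_rescale: "0 < l \<Longrightarrow> closure (rescale p l X) = rescale p l (closure X)"
  by (simp add: rescale_eq closure_scaleR[symmetric] closure_translation_subtract)

lemma frontier_rescale:
  assumes "0 < l"
  shows "frontier (rescale p l X) = rescale p l (frontier X)"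
proof -
  have inj: "inj (\<lambda>z::complex. (z - p) / of_real l)" using assms by (auto simp: inj_def)
  have surj: "surj (\<lambda>z::complex. (z - p) / of_real l)"
    using assms by (intro surjI[of _ "\<lambda>w. w * of_real l + p"]) auto
  have "- rescale p l X = rescale p l (- X)"
    unfolding rescale_def by (rule bij_image_Compl_eq[symmetric]) (use inj surj in \<open>auto simp: bij_def\<close>)
  then show ?thesis
    using assms by (simp add: frontier_closures closure_rescale) (simp add: rescale_def image_Int[OF inj])
qed

lemma open_rescale: "0 < l \<Longrightarrow> open X \<Longrightarrow> open (rescale p l X)"
  by (simp add: rescale_eq open_scaling open_translation_subtract)

lemma infdist_rescale_ge:
  assumes "0 < l" "closed X" "X \<noteq> {}"
  shows "infdist z X / l \<le> infdist ((z - p) / of_real l) (rescale p l X)"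
proof -
  have "closed (rescale p l X)"
    using assms by (simp add: rescale_eq closed_scaling closed_translation_subtract)
  moreover have "rescale p l X \<noteq> {}" using assms by (simp add: rescale_def)
  ultimately obtain y' where y': "y' \<in> rescale p l X"
      "infdist ((z - p) / of_real l) (rescale p l X) = dist ((z - p) / of_real l) y'"
    by (rule infdist_attains_inf)
  then obtain y where y: "y \<in> X" "y' = (y - p) / of_real l" by (auto simp: rescale_def)
  then show ?thesis using y' assms(1) by (simp add: dist_rescale infdist_le divide_right_mono)
qed

section \<open>Carrots\<close>

text \<open>A 1-Lipschitz parameter instead of arc length survives uniform limits, in which length
  may drop. The slack \<open>\<epsilon>\<close> admits polygonal approximations. No domain is
  mentioned: for \<open>\<epsilon> = 0\<close> the inequality itself keeps the curve off
  \<open>X\<close> at positive times.\<close>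

definition carrot :: "real \<Rightarrow> real \<Rightarrow> complex set \<Rightarrow> complex \<Rightarrow> real \<Rightarrow> complex \<Rightarrow> bool" where
  "carrot A \<epsilon> X a L P \<longleftrightarrow> 0 \<le> L \<and>
     (\<exists>g. 1-lipschitz_on {0..L} g \<and> g 0 = a \<and> g L = P \<and> (\<forall>t\<in>{0..L}. t \<le> A * infdist (g t) X + \<epsilon>))"

definition carrot_set :: "real \<Rightarrow> complex set \<Rightarrow> complex \<Rightarrow> complex set" where
  "carrot_set A X a = {P. \<exists>L. carrot A 0 X a L P}"

lemma carrot_refl: "0 \<le> A \<Longrightarrow> 0 \<le> \<epsilon> \<Longrightarrow> carrot A \<epsilon> X a 0 a"
  unfolding carrot_def by (auto intro!: exI[of _ "\<lambda>_. a"] lipschitz_intros simp: infdist_nonneg)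

lemma carrot_setI: "carrot A 0 X a L P \<Longrightarrow> P \<in> carrot_set A X a"
  by (auto simp: carrot_set_def)

lemma carrot_bound: "carrot A \<epsilon> X a L P \<Longrightarrow> 0 \<le> L \<and> L \<le> A * infdist P X + \<epsilon>"
  unfolding carrot_def by force

lemma carrot_dist: "carrot A \<epsilon> X a L P \<Longrightarrow> dist a P \<le> L"
  unfolding carrot_def by (auto dest: lipschitz_onD[of 1 "{0..L}" _ 0 L])

lemma carrot_extend:
  assumes c: "carrot A \<epsilon> X a L w" and "norm e \<le> 1" "0 \<le> d"
    and le: "\<And>v. 0 \<le> v \<Longrightarrow> v \<le> d \<Longrightarrow> L + v \<le> A * infdist (w + v *\<^sub>R e) X + \<epsilon>"
  shows "carrot A \<epsilon> X a (L + d) (w + d *\<^sub>R e)"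
proof -
  from c obtain g where g: "0 \<le> L" "1-lipschitz_on {0..L} g" "g 0 = a" "g L = w"
    "\<And>t. t \<in> {0..L} \<Longrightarrow> t \<le> A * infdist (g t) X + \<epsilon>" by (auto simp: carrot_def)
  define h where "h t = w + (t - L) *\<^sub>R e" for t
  have h_le: "t \<le> A * infdist (h t) X + \<epsilon>" if "L \<le> t" "t \<le> L + d" for t
    using le[of "t - L"] that by (simp add: h_def)
  have "1-lipschitz_on {L..L+d} h"
  proof (rule lipschitz_onI)
    fix x y
    have "dist (h x) (h y) = \<bar>x - y\<bar> * norm e"
      by (simp add: h_def dist_norm flip: scaleR_diff_left)
    also have "\<dots> \<le> \<bar>x - y\<bar> * 1" using assms(2) by (intro mult_left_mono) auto
    finally show "dist (h x) (h y) \<le> 1 * dist x y" by (simp add: dist_norm)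
  qed simp
  then have "1-lipschitz_on {0..L+d} (\<lambda>t. if t \<le> L then g t else h t)"
    using g by (intro lipschitz_on_concat) (auto simp: h_def)
  then show ?thesis unfolding carrot_def using g \<open>0 \<le> d\<close> h_le
    by (intro conjI exI[of _ "\<lambda>t. if t \<le> L then g t else h t"]) (auto simp: h_def)
qed

lemma carrot_extend_segment:
  assumes c: "carrot A \<epsilon> X a L w"
    and le: "\<And>z. z \<in> closed_segment w P \<Longrightarrow> L + dist w z \<le> A * infdist z X + \<epsilon>"
  shows "carrot A \<epsilon> X a (L + dist w P) P"
proof (cases "w = P")
  case False
  define e where "e = (1 / dist w P) *\<^sub>R (P - w)"
  have e: "norm e = 1" "w + dist w P *\<^sub>R e = P" using False by (auto simp: e_def dist_norm norm_minus_commute)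
  have "carrot A \<epsilon> X a (L + dist w P) (w + dist w P *\<^sub>R e)"
  proof (rule carrot_extend[OF c])
    fix v assume v: "0 \<le> v" "v \<le> dist w P"
    have "w + v *\<^sub>R e = (1 - v / dist w P) *\<^sub>R w + (v / dist w P) *\<^sub>R P"
      by (simp add: e_def algebra_simps)
    then have "w + v *\<^sub>R e \<in> closed_segment w P"
      using v False by (auto simp: in_segment intro!: exI[of _ "v / dist w P"])
    from le[OF this] show "L + v \<le> A * infdist (w + v *\<^sub>R e) X + \<epsilon>"
      using v e by (simp add: dist_norm)
  qed (use e in auto)
  then show ?thesis using e by simp
qed (use c in auto)

lemma convergent_subsequence:
  fixes f :: "nat \<Rightarrow> 'a::metric_space"
  assumes "compact S" "\<And>n. f n \<in> S"
  obtains l k where "l \<in> S" "strict_mono (k :: nat \<Rightarrow> nat)" "(\<lambda>n. f (k n)) \<longlonglongrightarrow> l"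
  using assms unfolding compact_def comp_def by blast

lemma infdist_tendsto_moving:
  fixes X :: "nat \<Rightarrow> 'a::metric_space set"
  assumes "\<And>z. (\<lambda>n. infdist z (X n)) \<longlonglongrightarrow> infdist z Y" and "P \<longlonglongrightarrow> p"
  shows "(\<lambda>n. infdist (P n) (X n)) \<longlonglongrightarrow> infdist p Y"
proof (rule Lim_transform[OF assms(1)])
  have lim: "(\<lambda>n. dist (P n) p) \<longlonglongrightarrow> 0"
    using assms(2) tendsto_dist_iff by blast
  show "(\<lambda>n. infdist (P n) (X n) - infdist p (X n)) \<longlonglongrightarrow> 0"
    by (rule Lim_null_comparison[OF always_eventually lim]) (simp add: infdist_triangle_abs)
qed

text \<open>The lengths are bounded, since \<open>L n\<close> is at most
  \<open>A * infdist (P n) (X n) + \<epsilon> n\<close>, which converges. Arzela--Ascoli then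
  provides a limit curve, and the inequality passes to the limit pointwise.\<close>

lemma carrot_limit:
  assumes A: "0 \<le> A" and conv: "\<And>z. (\<lambda>n. infdist z (X n)) \<longlonglongrightarrow> infdist z Y"
    and P: "P \<longlonglongrightarrow> p" and \<epsilon>: "\<epsilon> \<longlonglongrightarrow> 0"
    and c: "\<And>n. carrot A (\<epsilon> n) (X n) a (L n) (P n)"
  shows "p \<in> carrot_set A Y a"
proof -
  have L: "0 \<le> L n" "L n \<le> A * infdist (P n) (X n) + \<epsilon> n" for n using carrot_bound[OF c] by auto
  have "(\<lambda>n. A * infdist (P n) (X n) + \<epsilon> n) \<longlonglongrightarrow> A * infdist p Y + 0"
    by (intro tendsto_intros infdist_tendsto_moving[OF conv P] \<epsilon>)
  then have "Bseq (\<lambda>n. A * infdist (P n) (X n) + \<epsilon> n)"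
    by (intro convergent_imp_Bseq convergentI)
  then obtain S where S: "\<And>n. norm (A * infdist (P n) (X n) + \<epsilon> n) \<le> S" "0 < S"
    by (auto simp: Bseq_def)
  have LS: "L n \<le> S" for n using L(2)[of n] S(1)[of n] by simp
  obtain g where g: "\<And>n. 1-lipschitz_on {0..L n} (g n)" "\<And>n. g n 0 = a" "\<And>n. g n (L n) = P n"
    "\<And>n t. t \<in> {0..L n} \<Longrightarrow> t \<le> A * infdist (g n t) (X n) + \<epsilon> n"
    using c unfolding carrot_def by metis
  have "\<And>n. L n \<in> {0..S}" using L LS by auto
  from convergent_subsequence[OF compact_Icc this] obtain l k
    where k: "strict_mono (k :: nat \<Rightarrow> nat)" "(\<lambda>n. L (k n)) \<longlonglongrightarrow> l" .
  \<comment> \<open>Each curve rests at its tip after time \<open>L (k n)\<close>, so that all of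
    them live on the common interval \<open>{0..S}\<close>.\<close>
  define F where "F n t = g (k n) (min t (L (k n)))" for n t
  have F_lip: "dist (F n x) (F n y) \<le> dist x y" if "x \<ge> 0" "y \<ge> 0" for n x y
  proof -
    have "dist (F n x) (F n y) \<le> 1 * dist (min x (L (k n))) (min y (L (k n)))"
      unfolding F_def using that L by (intro lipschitz_onD[OF g(1)]) auto
    also have "\<dots> \<le> dist x y" by (auto simp: dist_real_def min_def)
    finally show ?thesis .
  qed
  have F0: "F n 0 = a" for n using L(1)[of "k n"] by (simp add: F_def g)
  have "norm (F n x) \<le> norm a + S" if "x \<in> {0..S}" for n x
    using F_lip[of x 0 n] that norm_triangle_ineq2[of "F n x" a] by (simp add: F0 dist_norm)
  moreover have "\<exists>d>0. \<forall>n y. y \<in> {0..S} \<and> norm (x - y) < d \<longrightarrow> norm (F n x - F n y) < e"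
    if "x \<in> {0..S}" "0 < e" for x e
  proof (intro exI[of _ e] conjI allI impI)
    fix n y assume "y \<in> {0..S} \<and> norm (x - y) < e"
    then show "norm (F n x - F n y) < e" using that F_lip[of x y n] by (auto simp: dist_norm)
  qed (use that in auto)
  ultimately obtain G j where j: "strict_mono (j :: nat \<Rightarrow> nat)"
    and unif: "\<And>e. 0 < e \<Longrightarrow> \<exists>N. \<forall>n x. n \<ge> N \<and> x \<in> {0..S} \<longrightarrow> norm (F (j n) x - G x) < e"
    using Arzela_Ascoli[of "{0..S}" F "norm a + S"] by (metis compact_Icc)
  have lim: "(\<lambda>n. F (j n) x) \<longlonglongrightarrow> G x" if "x \<in> {0..S}" for x
    using unif that unfolding lim_sequentially dist_norm by blast
  have kj: "strict_mono (\<lambda>n. k (j n))" using k j by (simp add: strict_mono_def)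
  have L_lim: "(\<lambda>n. L (k (j n))) \<longlonglongrightarrow> l" using LIMSEQ_subseq_LIMSEQ[OF k(2) j] by (simp add: comp_def)
  have P_lim: "(\<lambda>n. P (k (j n))) \<longlonglongrightarrow> p" using LIMSEQ_subseq_LIMSEQ[OF P kj] by (simp add: comp_def)
  have \<epsilon>_lim: "(\<lambda>n. \<epsilon> (k (j n))) \<longlonglongrightarrow> 0" using LIMSEQ_subseq_LIMSEQ[OF \<epsilon> kj] by (simp add: comp_def)
  have conv': "(\<lambda>n. infdist z (X (k (j n)))) \<longlonglongrightarrow> infdist z Y" for z
    using LIMSEQ_subseq_LIMSEQ[OF conv kj] by (simp add: comp_def)
  have l: "l \<in> {0..S}"
    using LIMSEQ_le_const[OF L_lim, of 0] LIMSEQ_le_const2[OF L_lim, of S] L LS by auto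
  have "1-lipschitz_on {0..l} G"
  proof (rule lipschitz_onI)
    fix x y assume xy: "x \<in> {0..l}" "y \<in> {0..l}"
    have "(\<lambda>n. dist (F (j n) x) (F (j n) y)) \<longlonglongrightarrow> dist (G x) (G y)"
      using xy l by (intro tendsto_dist lim) auto
    then show "dist (G x) (G y) \<le> 1 * dist x y"
      by (rule LIMSEQ_le_const2) (use F_lip xy in auto)
  qed simp
  moreover have "G 0 = a" using lim[of 0] S(2) by (simp add: F0 LIMSEQ_const_iff)
  moreover have "G l = p"
  proof -
    have le: "dist (F (j n) l) (P (k (j n))) \<le> dist (L (k (j n))) l" for n
    proof -
      have "P (k (j n)) = F (j n) (L (k (j n)))" by (simp add: F_def g)
      then show ?thesis
        using F_lip[of l "L (k (j n))" "j n"] l L by (simp add: dist_commute)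
    qed
    have 0: "(\<lambda>n. dist (L (k (j n))) l) \<longlonglongrightarrow> 0" by (rule tendsto_dist_iff[THEN iffD1, OF L_lim])
    have 1: "(\<lambda>n. dist (F (j n) l) (P (k (j n)))) \<longlonglongrightarrow> 0"
      by (rule tendsto_sandwich[OF _ _ tendsto_const 0]) (auto simp: le)
    from LIMSEQ_unique[OF 1 tendsto_dist[OF lim[OF l] P_lim]] show ?thesis by simp
  qed
  moreover have "t \<le> A * infdist (G t) Y + 0" if t: "t \<in> {0..l}" for t
  proof (rule LIMSEQ_le)
    \<comment> \<open>The carrot inequality says nothing beyond \<open>L (k (j n))\<close>, which
      can be smaller than \<open>t\<close> when \<open>t = l\<close>; truncating the left side keeps
      it valid without changing the limit.\<close>
    show "(\<lambda>n. min t (L (k (j n)))) \<longlonglongrightarrow> t"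
      using tendsto_min[OF tendsto_const[of t] L_lim] t by (simp add: min_absorb1)
    show "(\<lambda>n. A * infdist (F (j n) t) (X (k (j n))) + \<epsilon> (k (j n))) \<longlonglongrightarrow> A * infdist (G t) Y + 0"
      using t l by (intro tendsto_add[OF tendsto_mult[OF tendsto_const] \<epsilon>_lim]
          infdist_tendsto_moving[OF conv' lim]) auto
    show "\<exists>N. \<forall>n\<ge>N. min t (L (k (j n))) \<le> A * infdist (F (j n) t) (X (k (j n))) + \<epsilon> (k (j n))"
      unfolding F_def using t L by (intro exI allI impI g(4)) auto
  qed
  ultimately have "carrot A 0 Y a l p" using l unfolding carrot_def by auto
  then show ?thesis by (rule carrot_setI)
qed

lemma closed_carrot_set: "0 \<le> A \<Longrightarrow> closed (carrot_set A X a)"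
  unfolding closed_sequential_limits
proof (intro allI impI)
  fix P p assume A: "0 \<le> A" and "(\<forall>n. P n \<in> carrot_set A X a) \<and> P \<longlonglongrightarrow> p"
  then have "\<forall>n. \<exists>L. carrot A 0 X a L (P n)" and P: "P \<longlonglongrightarrow> p" by (auto simp: carrot_set_def)
  then obtain L where "\<And>n. carrot A 0 X a (L n) (P n)" by metis
  then show "p \<in> carrot_set A X a"
    by (intro carrot_limit[OF A, of "\<lambda>_. X" X P p "\<lambda>_. 0"] P) auto
qed

section \<open>Carrots from curves of finite length\<close>

lemma curve_length_ge:
  assumes "t 0 = a" "t n = b" "\<And>i. i < n \<Longrightarrow> t i \<le> t (Suc i)"
  shows "ennreal (\<Sum>i<n. dist (g (t i)) (g (t (Suc i)))) \<le> curve_length g a b"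
  unfolding curve_length_def
  by (rule SUP_upper2[of "(n, t)"]) (use assms in auto)

lemma curve_length_leI:
  assumes "\<And>n t. t 0 = a \<Longrightarrow> t n = b \<Longrightarrow> (\<And>i. i < n \<Longrightarrow> t i \<le> t (Suc i)) \<Longrightarrow>
    ennreal (\<Sum>i<n. dist (g (t i)) (g (t (Suc i)))) \<le> c"
  shows "curve_length g a b \<le> c"
  unfolding curve_length_def by (rule SUP_least) (use assms in auto)

lemma curve_length_mono_right:
  assumes "b \<le> c"
  shows "curve_length g a b \<le> curve_length g a c"
proof (rule curve_length_leI)
  fix n :: nat and t :: "nat \<Rightarrow> real"
  assume t: "t 0 = a" "t n = b" "\<And>i. i < n \<Longrightarrow> t i \<le> t (Suc i)"
  define t' where "t' i = (if i \<le> n then t i else c)" for i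
  have "(\<Sum>i<n. dist (g (t i)) (g (t (Suc i)))) = (\<Sum>i<n. dist (g (t' i)) (g (t' (Suc i))))"
    by (intro sum.cong) (auto simp: t'_def)
  also have "\<dots> \<le> (\<Sum>i<Suc n. dist (g (t' i)) (g (t' (Suc i))))" by simp
  finally have "ennreal (\<Sum>i<n. dist (g (t i)) (g (t (Suc i))))
      \<le> ennreal (\<Sum>i<Suc n. dist (g (t' i)) (g (t' (Suc i))))" by (rule ennreal_leI)
  also have "\<dots> \<le> curve_length g a c"
    using t assms by (intro curve_length_ge) (auto simp: t'_def less_Suc_eq)
  finally show "ennreal (\<Sum>i<n. dist (g (t i)) (g (t (Suc i)))) \<le> curve_length g a c" .
qed

text \<open>Used for \<open>g\<close> and for its reversal, the inequality becomes an
  equality.\<close>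

lemma curve_length_reverse:
  "curve_length (\<lambda>t. g (1 - t)) (1 - b) (1 - a) \<le> curve_length g a b"
proof (rule curve_length_leI)
  fix n :: nat and t :: "nat \<Rightarrow> real"
  assume t: "t 0 = 1 - b" "t n = 1 - a" "\<And>i. i < n \<Longrightarrow> t i \<le> t (Suc i)"
  define t' where "t' i = 1 - t (n - i)" for i
  have "(\<Sum>i<n. dist (g (1 - t i)) (g (1 - t (Suc i)))) = (\<Sum>i<n. dist (g (t' i)) (g (t' (Suc i))))"
    by (rule sum.reindex_bij_witness[of _ "\<lambda>i. n - Suc i" "\<lambda>i. n - Suc i"])
      (auto simp: t'_def dist_commute Suc_diff_Suc)
  also have "ennreal \<dots> \<le> curve_length g a b"
  proof (rule curve_length_ge)
    fix i assume "i < n"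
    then show "t' i \<le> t' (Suc i)"
      using t(3)[of "n - Suc i"] by (simp add: t'_def Suc_diff_Suc)
  qed (use t in \<open>auto simp: t'_def\<close>)
  finally show "ennreal (\<Sum>i<n. dist (g (1 - t i)) (g (1 - t (Suc i)))) \<le> curve_length g a b" .
qed

lemma curve_length_le_lipschitz:
  assumes "C-lipschitz_on {a..b} g" "a \<le> b"
  shows "curve_length g a b \<le> ennreal (C * (b - a))"
proof (rule curve_length_leI)
  fix n :: nat and t :: "nat \<Rightarrow> real"
  assume t: "t 0 = a" "t n = b" "\<And>i. i < n \<Longrightarrow> t i \<le> t (Suc i)"
  have lb: "i \<le> n \<Longrightarrow> a \<le> t i" for i
  proof (induction i)
    case (Suc i)
    then show ?case using t(3)[of i] by simp
  qed (use t in auto)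
  have ub: "i \<le> n \<Longrightarrow> t (n - i) \<le> b" for i
  proof (induction i)
    case (Suc i)
    then show ?case using t(3)[of "n - Suc i"] by (simp add: Suc_diff_Suc)
  qed (use t in auto)
  have "(\<Sum>i<n. dist (g (t i)) (g (t (Suc i)))) \<le> (\<Sum>i<n. C * (t (Suc i) - t i))"
  proof (rule sum_mono)
    fix i assume i: "i \<in> {..<n}"
    then have "dist (g (t i)) (g (t (Suc i))) \<le> C * dist (t i) (t (Suc i))"
      using lb[of i] lb[of "Suc i"] ub[of "n - i"] ub[of "n - Suc i"]
      by (intro lipschitz_onD[OF assms(1)]) auto
    then show "dist (g (t i)) (g (t (Suc i))) \<le> C * (t (Suc i) - t i)"
      using t(3)[of i] i by (simp add: dist_real_def)
  qed
  also have "\<dots> = C * (b - a)"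
    using t(1,2) by (simp add: sum_lessThan_telescope flip: sum_distrib_left)
  finally show "ennreal (\<Sum>i<n. dist (g (t i)) (g (t (Suc i)))) \<le> ennreal (C * (b - a))"
    by (rule ennreal_leI)
qed

lemma dist_to_eq_infdist:
  assumes "closed X" "X \<noteq> {}"
  shows "dist_to z X = ennreal (infdist z X)"
proof (rule antisym)
  obtain y where "y \<in> X" "infdist z X = dist z y" using infdist_attains_inf[OF assms] by blast
  then show "dist_to z X \<le> ennreal (infdist z X)" by (auto simp: dist_to_def intro: INF_lower2)
  show "ennreal (infdist z X) \<le> dist_to z X"
    by (auto simp: dist_to_def intro!: INF_greatest ennreal_leI infdist_le)
qed

text \<open>Inscribed polygons of mesh \<open>\<epsilon>\<close> are carrots up to an error \<open>(A + 1) \<epsilon>\<close>; let \<open>\<epsilon>\<close> tend to 0.\<close>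

lemma carrot_set_of_curve:
  assumes A: "0 \<le> A" and cont: "continuous_on {0..T} g" and T: "0 \<le> T"
    and le: "\<And>t. t \<in> {0..T} \<Longrightarrow> curve_length g 0 t \<le> ennreal (A * infdist (g t) X)"
  shows "g T \<in> carrot_set A X (g 0)"
proof -
  have "\<exists>L. carrot A ((A + 1) * \<epsilon>) X (g 0) L (g T)" if "0 < \<epsilon>" for \<epsilon>
  proof -
    have "uniformly_continuous_on {0..T} g" using cont by (simp add: compact_uniformly_continuous)
    then obtain \<delta> where \<delta>: "\<delta> > 0"
      "\<And>x y. x \<in> {0..T} \<Longrightarrow> y \<in> {0..T} \<Longrightarrow> dist x y < \<delta> \<Longrightarrow> dist (g x) (g y) < \<epsilon>"
      using \<open>0 < \<epsilon>\<close> by (auto simp: uniformly_continuous_on_def)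
    obtain N :: nat where N: "T / \<delta> < N" using reals_Archimedean2 by blast
    have "N > 0" using N T \<delta>(1) by (metis divide_nonneg_pos gr0I less_le_not_le of_nat_0)
    define t where "t i = real i * (T / N)" for i
    have t_in: "t i \<in> {0..T}" if "i \<le> N" for i
      using that T \<open>N > 0\<close> by (auto simp: t_def field_simps intro: mult_left_mono)
    have t_mono: "t i \<le> t (Suc i)" for i
      unfolding t_def using T by (intro mult_right_mono) auto
    have step: "dist (g (t i)) (g (t (Suc i))) < \<epsilon>" if "i < N" for i
    proof (rule \<delta>(2))
      have "dist (t i) (t (Suc i)) = T / N" 
        using T by (simp add: t_def dist_real_def algebra_simps add_divide_distrib)
      also have "\<dots> < \<delta>" using N \<open>N > 0\<close> \<delta>(1) by (simp add: field_simps)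
      finally show "dist (t i) (t (Suc i)) < \<delta>" .
    qed (use that t_in in auto)
    define S where "S i = (\<Sum>j<i. dist (g (t j)) (g (t (Suc j))))" for i
    have S_le: "S i \<le> A * infdist (g (t i)) X" if "i \<le> N" for i
    proof -
      have "ennreal (S i) \<le> curve_length g 0 (t i)"
        unfolding S_def by (rule curve_length_ge) (auto simp: t_mono, simp add: t_def)
      then have "ennreal (S i) \<le> ennreal (A * infdist (g (t i)) X)"
        using le[OF t_in[OF that]] by (rule order_trans)
      then show ?thesis using A by (simp add: ennreal_le_iff infdist_nonneg)
    qed
    have "carrot A ((A + 1) * \<epsilon>) X (g 0) (S i) (g (t i))" if "i \<le> N" for i
      using that
    proof (induction i)
      case 0
      show ?case using A \<open>0 < \<epsilon>\<close> by (simp add: S_def t_def carrot_refl)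
    next
      case (Suc i)
      have "carrot A ((A + 1) * \<epsilon>) X (g 0) (S i + dist (g (t i)) (g (t (Suc i)))) (g (t (Suc i)))"
      proof (rule carrot_extend_segment)
        fix z assume "z \<in> closed_segment (g (t i)) (g (t (Suc i)))"
        then have d: "dist (g (t i)) z \<le> \<epsilon>"
          using step[of i] Suc.prems dist_in_closed_segment[of z "g (t i)" "g (t (Suc i))"]
          by (simp add: dist_commute)
        \<comment> \<open>The error \<open>(A + 1) * \<epsilon>\<close> has two sources:
          \<open>A * \<epsilon>\<close> from the distance at the preceding vertex, and
          \<open>\<epsilon>\<close> from the length of the current edge.\<close>
        have "A * infdist (g (t i)) X \<le> A * (infdist z X + \<epsilon>)"
          using A d infdist_triangle[of "g (t i)" X z] by (intro mult_left_mono) auto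
        then show "S i + dist (g (t i)) z \<le> A * infdist z X + (A + 1) * \<epsilon>"
          using S_le[of i] Suc.prems d by (simp add: algebra_simps)
      qed (use Suc in auto)
      then show ?case by (simp add: S_def)
    qed
    from this[of N] show ?thesis using \<open>N > 0\<close> by (auto simp: t_def)
  qed
  from this[of "1 / real (Suc _)"]
  have "\<exists>L. carrot A ((A + 1) * (1 / real (Suc n))) X (g 0) L (g T)" for n by simp
  then obtain L where "\<And>n. carrot A ((A + 1) * (1 / real (Suc n))) X (g 0) (L n) (g T)" by metis
  moreover have "(\<lambda>n. (A + 1) * (1 / real (Suc n))) \<longlonglongrightarrow> 0"
    using tendsto_mult_right_zero[OF LIMSEQ_inverse_real_of_nat, of "A + 1"] by (simp add: inverse_eq_divide)
  ultimately show ?thesis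
    by (intro carrot_limit[OF A, of "\<lambda>_. X" X "\<lambda>_. g T"]) auto
qed

text \<open>The John curve is cut at the supremum \<open>s\<close> of the times at which the initial
  piece is not longer than the final one. Before \<open>s\<close> the minimum is the initial length,
  after \<open>s\<close> it is the final length, so each piece consists of carrot tips.\<close>

lemma John_domain_carrots:
  assumes D: "John_domain A D" and ab: "a \<in> D" "b \<in> D" and ne: "frontier D \<noteq> {}"
  obtains Sa Sb m where "compact Sa" "connected Sa" "compact Sb" "connected Sb"
    "Sa \<subseteq> D" "Sb \<subseteq> D" "a \<in> Sa" "b \<in> Sb" "m \<in> Sa" "m \<in> Sb"
    "Sa \<subseteq> carrot_set A (frontier D) a" "Sb \<subseteq> carrot_set A (frontier D) b"
proof (cases "a = b")
  case True
  have "1 \<le> A" using D by (simp add: John_domain_def)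
  then show ?thesis using True ab carrot_setI[OF carrot_refl]
    by (intro that[of "{a}" "{a}" a]) auto
next
  case False
  have A: "1 \<le> A" using D by (simp add: John_domain_def)
  obtain g where g: "path g" "path_image g \<subseteq> D" "pathstart g = a" "pathfinish g = b"
    and g_min: "\<And>t. t \<in> {0..1} \<Longrightarrow>
      min (curve_length g 0 t) (curve_length g t 1) \<le> ennreal A * dist_to (g t) (frontier D)"
    using D ab False unfolding John_domain_def by metis
  have g01: "g 0 = a" "g 1 = b" using g by (auto simp: pathstart_def pathfinish_def)
  have cont: "continuous_on S g" if "S \<subseteq> {0..1}" for S
    using g(1) that by (auto simp: path_def intro: continuous_on_subset)
  have rhs: "ennreal A * dist_to z (frontier D) = ennreal (A * infdist z (frontier D))" for z
    using A ne by (simp add: dist_to_eq_infdist ennreal_mult infdist_nonneg)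
  have mono_l: "curve_length g 0 s \<le> curve_length g 0 t" if "s \<le> t" for s t
    by (rule curve_length_mono_right[OF that])
  have rev: "curve_length (\<lambda>t. g (1 - t)) 0 (1 - t) = curve_length g t 1" for t
    using curve_length_reverse[of g 1 t] curve_length_reverse[of "\<lambda>t. g (1 - t)" "1 - t" 0] by simp
  have mono_r: "curve_length g t 1 \<le> curve_length g s 1" if "s \<le> t" for s t
    using curve_length_mono_right[of "1 - t" "1 - s" "\<lambda>t. g (1 - t)" 0] that by (simp add: rev)
  define T where "T = {t \<in> {0..1}. curve_length g 0 t \<le> curve_length g t 1}"
  have "curve_length g 0 0 \<le> ennreal (0 * (0 - 0))"
    by (rule curve_length_le_lipschitz) (auto intro!: lipschitz_onI)
  then have "0 \<in> T" by (auto simp: T_def)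
  have T_bdd: "bdd_above T" by (auto simp: T_def intro!: bdd_aboveI[of _ 1])
  define s where "s = Sup T"
  have s: "0 \<le> s" "s \<le> 1"
    unfolding s_def using \<open>0 \<in> T\<close>
    by (auto intro: cSup_upper[OF _ T_bdd] intro!: cSup_least) (auto simp: T_def)
  have left: "curve_length g 0 t \<le> ennreal (A * infdist (g t) (frontier D))" if "0 \<le> t" "t < s" for t
  proof -
    have "T \<noteq> {}" using \<open>0 \<in> T\<close> by auto
    moreover have "t < Sup T" using that(2) s_def by simp
    ultimately obtain t' where t': "t' \<in> T" "t < t'" using less_cSupD by metis
    have "curve_length g 0 t \<le> curve_length g 0 t'" using t' by (intro mono_l) auto
    also have "\<dots> \<le> curve_length g t' 1" using t' by (simp add: T_def)
    also have "\<dots> \<le> curve_length g t 1" using t' by (intro mono_r) auto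
    finally show ?thesis using g_min[of t] that s by (simp add: rhs min_def)
  qed
  have right: "curve_length g t 1 \<le> ennreal (A * infdist (g t) (frontier D))" if "s < t" "t \<le> 1" for t
  proof -
    have "t \<notin> T" using cSup_upper[OF _ T_bdd, of t] that by (auto simp: s_def)
    then show ?thesis using g_min[of t] that s by (auto simp: T_def rhs min_def split: if_splits)
  qed
  have "g t \<in> carrot_set A (frontier D) a" if "0 \<le> t" "t < s" for t
    using carrot_set_of_curve[of A t g "frontier D"] A that left s g01 cont by auto
  moreover have "a \<in> carrot_set A (frontier D) a" using A by (intro carrot_setI[OF carrot_refl]) auto
  \<comment> \<open>At \<open>s\<close> itself it is not known which length attains the minimum; the
    point is added because carrot sets are closed.\<close>
  ultimately have Sa: "g ` {0..s} \<subseteq> carrot_set A (frontier D) a"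
  proof (cases "s = 0")
    case False
    then have "closure {0..<s} = {0..s}" using s by simp
    then show ?thesis
      using image_closure_subset[of "{0..<s}" g "carrot_set A (frontier D) a"] A s
        closed_carrot_set[of A "frontier D" a] cont
        \<open>\<And>t. 0 \<le> t \<Longrightarrow> t < s \<Longrightarrow> g t \<in> carrot_set A (frontier D) a\<close> by fastforce
  qed (use g01 in auto)
  have "g t \<in> carrot_set A (frontier D) b" if "s < t" "t \<le> 1" for t
  proof -
    have "(\<lambda>t. g (1 - t)) (1 - t) \<in> carrot_set A (frontier D) ((\<lambda>t. g (1 - t)) 0)"
    proof (rule carrot_set_of_curve)
      show "continuous_on {0..1 - t} (\<lambda>t. g (1 - t))"
        using s that by (intro continuous_on_compose2[OF cont[of "{0..1}"]] continuous_intros) auto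
      show "curve_length (\<lambda>t. g (1 - t)) 0 u \<le> ennreal (A * infdist (g (1 - u)) (frontier D))"
        if "u \<in> {0..1 - t}" for u
        using right[of "1 - u"] rev[of "1 - u"] that \<open>s < t\<close> by auto
    qed (use A that in auto)
    then show ?thesis by (simp add: g01)
  qed
  moreover have "b \<in> carrot_set A (frontier D) b" using A by (intro carrot_setI[OF carrot_refl]) auto
  ultimately have Sb: "g ` {s..1} \<subseteq> carrot_set A (frontier D) b"
  proof (cases "s = 1")
    case False
    then have "closure {s<..1} = {s..1}" using s by simp
    then show ?thesis
      using image_closure_subset[of "{s<..1}" g "carrot_set A (frontier D) b"] A s
        closed_carrot_set[of A "frontier D" b] cont
        \<open>\<And>t. s < t \<Longrightarrow> t \<le> 1 \<Longrightarrow> g t \<in> carrot_set A (frontier D) b\<close> by fastforce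
  qed (use g01 in auto)
  show ?thesis
  proof (rule that[OF _ _ _ _ _ _ _ _ _ _ Sa Sb])
    show "g s \<in> g ` {0..s}" "g s \<in> g ` {s..1}" using s by auto
    show "a \<in> g ` {0..s}" "b \<in> g ` {s..1}" using s g01 by force+
    show "compact (g ` {0..s})" "compact (g ` {s..1})" "connected (g ` {0..s})" "connected (g ` {s..1})"
      using s by (auto intro!: compact_continuous_image connected_continuous_image cont)
    show "g ` {0..s} \<subseteq> D" "g ` {s..1} \<subseteq> D" using g(2) s by (auto simp: path_image_def)
  qed
qed

section \<open>Rescaling, limits, and John curves from carrots\<close>

text \<open>Lengths and distances both scale by \<open>1 / l\<close>, so \<open>A\<close> is
  preserved.\<close>

lemma carrot_set_rescale:
  assumes "0 \<le> A" "0 < l" "closed X" "X \<noteq> {}" and P: "P \<in> carrot_set A X a"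
  shows "(P - p) / of_real l \<in> carrot_set A (rescale p l X) ((a - p) / of_real l)"
proof -
  obtain L g where g: "0 \<le> L" "1-lipschitz_on {0..L} g" "g 0 = a" "g L = P"
    "\<And>t. t \<in> {0..L} \<Longrightarrow> t \<le> A * infdist (g t) X"
    using P by (auto simp: carrot_set_def carrot_def)
  define h where "h t = (g (l * t) - p) / of_real l" for t
  have in_range: "l * t \<in> {0..L}" if "t \<in> {0..L/l}" for t
    using that assms(2) by (auto simp: field_simps)
  have "1-lipschitz_on {0..L/l} h"
  proof (rule lipschitz_onI)
    fix x y assume xy: "x \<in> {0..L/l}" "y \<in> {0..L/l}"
    have "dist (h x) (h y) = dist (g (l * x)) (g (l * y)) / l"
      unfolding h_def by (rule dist_rescale[OF assms(2)])
    also have "\<dots> \<le> (1 * dist (l * x) (l * y)) / l"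
      using assms(2) xy by (intro divide_right_mono lipschitz_onD[OF g(2)] in_range) auto
    also have "\<dots> = 1 * dist x y"
      using assms(2) by (simp add: dist_real_def abs_mult flip: right_diff_distrib)
    finally show "dist (h x) (h y) \<le> 1 * dist x y" .
  qed simp
  moreover have "t \<le> A * infdist (h t) (rescale p l X) + 0" if "t \<in> {0..L/l}" for t
  proof -
    have "t = (l * t) / l" using assms(2) by simp
    also have "\<dots> \<le> (A * infdist (g (l * t)) X) / l"
      using assms(2) by (intro divide_right_mono g(5) in_range that) auto
    also have "\<dots> = A * (infdist (g (l * t)) X / l)" by simp
    also have "\<dots> \<le> A * infdist (h t) (rescale p l X)"
      unfolding h_def using assms by (intro mult_left_mono infdist_rescale_ge) auto
    finally show ?thesis by simp
  qed
  ultimately have "carrot A 0 (rescale p l X) ((a - p) / of_real l) (L/l) ((P - p) / of_real l)"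
    unfolding carrot_def using g assms(2) by (intro conjI exI[of _ h]) (auto simp: h_def)
  then show ?thesis by (rule carrot_setI)
qed

lemma John_domain_carrots_rescale:
  assumes D: "John_domain A D" and "0 < l" and ne: "frontier D \<noteq> {}"
    and ab: "a \<in> rescale p l D" "b \<in> rescale p l D"
  obtains Sa Sb m where "compact Sa" "connected Sa" "compact Sb" "connected Sb"
    "Sa \<subseteq> rescale p l D" "Sb \<subseteq> rescale p l D" "a \<in> Sa" "b \<in> Sb" "m \<in> Sa" "m \<in> Sb"
    "Sa \<subseteq> carrot_set A (rescale p l (frontier D)) a" "Sb \<subseteq> carrot_set A (rescale p l (frontier D)) b"
proof -
  let ?f = "\<lambda>z. (z - p) / of_real l"
  have A: "0 \<le> A" using D by (simp add: John_domain_def)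
  obtain a' b' where a': "a' \<in> D" "a = ?f a'" and b': "b' \<in> D" "b = ?f b'"
    using ab by (auto simp: rescale_def)
  obtain Sa Sb m where S: "compact Sa" "connected Sa" "compact Sb" "connected Sb"
    "Sa \<subseteq> D" "Sb \<subseteq> D" "a' \<in> Sa" "b' \<in> Sb" "m \<in> Sa" "m \<in> Sb"
    "Sa \<subseteq> carrot_set A (frontier D) a'" "Sb \<subseteq> carrot_set A (frontier D) b'"
    by (rule John_domain_carrots[OF D a'(1) b'(1) ne])
  have cont: "continuous_on S ?f" for S using \<open>0 < l\<close> by (intro continuous_intros) auto
  show ?thesis
  proof (rule that[of "?f ` Sa" "?f ` Sb" "?f m"])
    show "?f ` Sa \<subseteq> rescale p l D" "?f ` Sb \<subseteq> rescale p l D" using S by (auto simp: rescale_def)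
    show "?f ` Sa \<subseteq> carrot_set A (rescale p l (frontier D)) a"
      "?f ` Sb \<subseteq> carrot_set A (rescale p l (frontier D)) b"
      unfolding a' b' using S carrot_set_rescale[OF A \<open>0 < l\<close> frontier_closed ne] by auto
  qed (use S a' b' cont in \<open>auto intro!: compact_continuous_image connected_continuous_image\<close>)
qed

text \<open>One carrot followed by the other reversed is the John curve. A point of it on
  \<open>Y\<close> would have carrot parameter 0, hence be \<open>a\<close> or \<open>b\<close>; so
  the curve stays in the component \<open>U\<close>. Since \<open>frontier U\<close> is a subset of
  \<open>Y\<close>, distances to it are no smaller than distances to \<open>Y\<close>.\<close>

lemma John_domain_of_carrots:
  assumes Y: "closed Y" "Y \<noteq> {}" and U: "U \<in> components (- Y)" and A: "1 \<le> A"
    and meet: "\<And>a b. a \<in> U \<Longrightarrow> b \<in> U \<Longrightarrow> a \<noteq> b \<Longrightarrow> carrot_set A Y a \<inter> carrot_set A Y b \<noteq> {}"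
  shows "John_domain A U"
  unfolding John_domain_def domain_def
proof (intro conjI ballI impI)
  have "open (- Y)" using Y by auto
  then show "open U" using U by (rule open_components)
  show "connected U" "U \<noteq> {}" using U in_components_connected in_components_nonempty by auto
  fix a b assume ab: "a \<in> U" "b \<in> U" "a \<noteq> b"
  then obtain m where m: "m \<in> carrot_set A Y a" "m \<in> carrot_set A Y b" using meet by blast
  obtain L1 g1 where g1: "0 \<le> L1" "1-lipschitz_on {0..L1} g1" "g1 0 = a" "g1 L1 = m"
    "\<And>t. t \<in> {0..L1} \<Longrightarrow> t \<le> A * infdist (g1 t) Y"
    using m(1) by (auto simp: carrot_set_def carrot_def)
  obtain L2 g2 where g2: "0 \<le> L2" "1-lipschitz_on {0..L2} g2" "g2 0 = b" "g2 L2 = m"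
    "\<And>t. t \<in> {0..L2} \<Longrightarrow> t \<le> A * infdist (g2 t) Y"
    using m(2) by (auto simp: carrot_set_def carrot_def)
  define h where "h t = (if t \<le> 1/2 then g1 (2 * t * L1) else g2 ((2 - 2 * t) * L2))" for t
  have h_right: "h t = g2 ((2 - 2 * t) * L2)" if "1/2 \<le> t" for t
  proof (cases "t = 1/2")
    case True
    show ?thesis unfolding True using g1(4) g2(4) by (simp add: h_def)
  qed (use that in \<open>simp add: h_def\<close>)
  have in1: "2 * t * L1 \<in> {0..L1}" if "0 \<le> t" "t \<le> 1/2" for t
    using that g1(1) mult_right_mono[of "2 * t" 1 L1] by auto
  have in2: "(2 - 2 * t) * L2 \<in> {0..L2}" if "1/2 \<le> t" "t \<le> 1" for t
    using that g2(1) mult_right_mono[of "2 - 2 * t" 1 L2] by auto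
  have lip1: "(2 * L1)-lipschitz_on {0..1/2} h"
  proof (rule lipschitz_onI)
    fix x y :: real assume xy: "x \<in> {0..1/2}" "y \<in> {0..1/2}"
    then have "dist (h x) (h y) \<le> 1 * dist (2 * x * L1) (2 * y * L1)"
      unfolding h_def using lipschitz_onD[OF g1(2) in1[of x] in1[of y]] by auto
    also have "\<dots> = \<bar>(x - y) * (2 * L1)\<bar>" by (simp add: dist_real_def algebra_simps)
    also have "\<dots> = 2 * L1 * dist x y"
      by (subst abs_mult) (use g1(1) in \<open>simp add: dist_real_def\<close>)
    finally show "dist (h x) (h y) \<le> 2 * L1 * dist x y" .
  qed (use g1 in auto)
  have lip2: "(2 * L2)-lipschitz_on {1/2..1} h"
  proof (rule lipschitz_onI)
    fix x y :: real assume xy: "x \<in> {1/2..1}" "y \<in> {1/2..1}"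
    then have "dist (h x) (h y) \<le> 1 * dist ((2 - 2 * x) * L2) ((2 - 2 * y) * L2)"
      using lipschitz_onD[OF g2(2) in2[of x] in2[of y]] by (auto simp: h_right)
    also have "\<dots> = \<bar>(y - x) * (2 * L2)\<bar>" by (simp add: dist_real_def algebra_simps)
    also have "\<dots> = 2 * L2 * dist x y"
      by (subst abs_mult) (use g2(1) in \<open>simp add: dist_real_def abs_minus_commute\<close>)
    finally show "dist (h x) (h y) \<le> 2 * L2 * dist x y" .
  qed (use g2 in auto)
  have cont: "continuous_on {0..1} h"
  proof -
    have "continuous_on ({0..1/2} \<union> {1/2..1}) h"
      using lip1 lip2 by (intro continuous_on_closed_Un) (auto intro: lipschitz_on_continuous_on)
    moreover have "{0..1/2} \<union> {1/2..1} = {0..1::real}" by auto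
    ultimately show ?thesis by simp
  qed
  have h01: "h 0 = a" "h 1 = b" using g1 g2 by (auto simp: h_def)
  have bound1: "2 * t * L1 \<le> A * infdist (h t) Y" if "0 \<le> t" "t \<le> 1/2" for t
    using g1(5)[OF in1[OF that]] that by (simp add: h_def)
  have bound2: "(2 - 2 * t) * L2 \<le> A * infdist (h t) Y" if "1/2 \<le> t" "t \<le> 1" for t
    using g2(5)[OF in2[OF that]] that by (simp add: h_right)
  have "h t \<notin> Y" if t: "t \<in> {0..1}" for t
  proof
    assume "h t \<in> Y"
    then have 0: "A * infdist (h t) Y = 0" by simp
    have "h t = a \<or> h t = b"
    proof (cases "t \<le> 1/2")
      case True
      then have *: "2 * t * L1 = 0" using bound1[of t] in1[of t] 0 t by auto
      show ?thesis using True g1(3) unfolding h_def * by simp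
    next
      case False
      then have *: "(2 - 2 * t) * L2 = 0" using bound2[of t] in2[of t] 0 t by auto
      show ?thesis using False g2(3) unfolding h_def * by simp
    qed
    then show False using ab in_components_subset[OF U] \<open>h t \<in> Y\<close> by auto
  qed
  then have "h ` {0..1} \<subseteq> - Y" by auto
  moreover have "connected (h ` {0..1})" by (intro connected_continuous_image cont) auto
  moreover have "a \<in> h ` {0..1}" using h01 by force
  ultimately have sub: "h ` {0..1} \<subseteq> U"
    using components_maximal[OF U, of "h ` {0..1}"] ab by blast
  have fr: "frontier U \<subseteq> Y" using frontier_of_components_closed_complement[OF Y(1) U] .
  have dist_ge: "ennreal (A * infdist z Y) \<le> ennreal A * dist_to z (frontier U)" for z
  proof -
    have "ennreal (infdist z Y) \<le> dist_to z (frontier U)"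
      unfolding dist_to_def using fr by (intro INF_greatest ennreal_leI infdist_le) auto
    then have "ennreal A * ennreal (infdist z Y) \<le> ennreal A * dist_to z (frontier U)"
      by (rule mult_left_mono) simp
    then show ?thesis using A by (simp add: ennreal_mult infdist_nonneg)
  qed
  have "min (curve_length h 0 t) (curve_length h t 1) \<le> ennreal A * dist_to (h t) (frontier U)"
    if t: "t \<in> {0..1}" for t
  proof (cases "t \<le> 1/2")
    case True
    have "curve_length h 0 t \<le> ennreal (2 * L1 * (t - 0))"
      using True t by (intro curve_length_le_lipschitz lipschitz_on_subset[OF lip1]) auto
    also have "\<dots> \<le> ennreal (A * infdist (h t) Y)"
      using bound1[of t] True t by (intro ennreal_leI) (simp add: mult_ac)
    finally show ?thesis using dist_ge[of "h t"] by (auto simp: min_le_iff_disj)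
  next
    case False
    have "curve_length h t 1 \<le> ennreal (2 * L2 * (1 - t))"
      using False t by (intro curve_length_le_lipschitz lipschitz_on_subset[OF lip2]) auto
    also have "\<dots> \<le> ennreal (A * infdist (h t) Y)"
      using bound2[of t] False t by (intro ennreal_leI) (simp add: algebra_simps)
    finally show ?thesis using dist_ge[of "h t"] by (auto simp: min_le_iff_disj)
  qed
  then show "\<exists>g. path g \<and> path_image g \<subseteq> U \<and> pathstart g = a \<and> pathfinish g = b \<and>
      (\<forall>t\<in>{0..1}. min (curve_length g 0 t) (curve_length g t 1) \<le> ennreal A * dist_to (g t) (frontier U))"
    using cont sub h01 by (intro exI[of _ h]) (auto simp: path_def path_image_def pathstart_def pathfinish_def)
qed (use A in auto)

lemma local_Hausdorff_conv_infdist: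
  assumes conv: "local_Hausdorff_conv X Y" and 0: "\<And>n. 0 \<in> X n"
  shows "0 \<in> Y" and "(\<lambda>n. infdist z (X n)) \<longlonglongrightarrow> infdist z Y"
proof -
  have cl: "closed Y" "closed (X n)" for n using conv by (auto simp: local_Hausdorff_conv_def)
  have ev: "\<exists>N. \<forall>n\<ge>N. X n \<inter> ball z (R - \<epsilon>) \<subseteq> nbhd \<epsilon> (Y \<inter> ball z R) \<and>
        Y \<inter> ball z (R - \<epsilon>) \<subseteq> nbhd \<epsilon> (X n \<inter> ball z R)" if "R > 0" "\<epsilon> > 0" for z R \<epsilon>
    using conv that by (simp add: local_Hausdorff_conv_def)
  show "0 \<in> Y"
  proof (rule ccontr)
    assume "0 \<notin> Y"
    then obtain \<epsilon> where \<epsilon>: "\<epsilon> > 0" "ball 0 \<epsilon> \<subseteq> - Y"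
      using cl(1) open_contains_ball[of "- Y"] by (auto simp: open_Compl)
    obtain N where "X N \<inter> ball 0 (\<epsilon> + 1 - \<epsilon>) \<subseteq> nbhd \<epsilon> (Y \<inter> ball 0 (\<epsilon> + 1))"
      using ev[of "\<epsilon> + 1" \<epsilon> 0] \<epsilon> by auto
    moreover have "0 \<in> X N \<inter> ball 0 (\<epsilon> + 1 - \<epsilon>)" using 0 by simp
    ultimately obtain y where "y \<in> Y" "0 \<in> ball y \<epsilon>" by (auto simp: nbhd_def)
    then show False using \<epsilon> by (auto simp: dist_commute)
  qed
  show "(\<lambda>n. infdist z (X n)) \<longlonglongrightarrow> infdist z Y"
  proof (rule LIMSEQ_I)
    fix e :: real assume "0 < e"
    define \<epsilon> where "\<epsilon> = e / 2"
    have \<epsilon>: "\<epsilon> > 0" using \<open>0 < e\<close> by (simp add: \<epsilon>_def)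
    \<comment> \<open>Because 0 belongs to all the sets, a nearest point to \<open>z\<close> is
      within \<open>norm z\<close> of \<open>z\<close>, and one ball of fixed radius suffices for
      all \<open>n\<close>.\<close>
    define R where "R = norm z + 1 + \<epsilon>"
    have close: "infdist z S' \<le> infdist z S + \<epsilon>"
      if S: "closed S" "0 \<in> S" "S \<inter> ball z (R - \<epsilon>) \<subseteq> nbhd \<epsilon> (S' \<inter> ball z R)" for S S'
    proof -
      have "S \<noteq> {}" using S(2) by auto
      then obtain y where y: "y \<in> S" "infdist z S = dist z y"
        using infdist_attains_inf[OF S(1)] by blast
      have "dist z y \<le> norm z" using infdist_le[OF S(2), of z] y(2) by simp
      then have "y \<in> nbhd \<epsilon> (S' \<inter> ball z R)" using S(3) y(1) by (auto simp: R_def)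
      then obtain w where "w \<in> S'" "dist w y < \<epsilon>" by (auto simp: nbhd_def)
      then show ?thesis using infdist_le[of w S' z] dist_triangle[of z w y] y(2)
        by (simp add: dist_commute)
    qed
    have "R > 0" using \<epsilon> by (simp add: R_def add_nonneg_pos)
    from ev[OF this \<epsilon>, of z] obtain N where N: "\<And>n. n \<ge> N \<Longrightarrow>
        X n \<inter> ball z (R - \<epsilon>) \<subseteq> nbhd \<epsilon> (Y \<inter> ball z R)"
        "\<And>n. n \<ge> N \<Longrightarrow> Y \<inter> ball z (R - \<epsilon>) \<subseteq> nbhd \<epsilon> (X n \<inter> ball z R)" by blast
    have "norm (infdist z (X n) - infdist z Y) < e" if "n \<ge> N" for n
      using close[OF cl(2) 0 N(1)[OF that]] close[OF cl(1) \<open>0 \<in> Y\<close> N(2)[OF that]] \<open>0 < e\<close>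
      by (simp add: \<epsilon>_def abs_le_iff)
    then show "\<exists>N. \<forall>n\<ge>N. norm (infdist z (X n) - infdist z Y) < e" by blast
  qed
qed

text \<open>A violation for infinitely many \<open>n\<close> would yield violating points with a
  limit outside \<open>V\<close>. The lemma turns statements about limits into statements for all
  large \<open>n\<close>, uniform on \<open>Q\<close>.\<close>

lemma eventually_on_compact:
  fixes Q :: "'a::metric_space set"
  assumes Q: "compact Q" and V: "open V"
    and lim: "\<And>k P p. strict_mono (k :: nat \<Rightarrow> nat) \<Longrightarrow> (\<And>j. P j \<in> Q) \<Longrightarrow> P \<longlonglongrightarrow> p \<Longrightarrow>
      (\<And>j. R (k j) (P j)) \<Longrightarrow> p \<in> Q \<Longrightarrow> p \<in> V"
  shows "\<forall>\<^sub>F n in sequentially. \<forall>P\<in>Q. R n P \<longrightarrow> P \<in> V"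
proof (rule ccontr)
  assume "\<not> ?thesis"
  then have "frequently (\<lambda>n. \<exists>P\<in>Q. R n P \<and> P \<notin> V) cofinite"
    by (simp add: not_eventually cofinite_eq_sequentially)
  then have "infinite {n. \<exists>P\<in>Q. R n P \<and> P \<notin> V}" by (simp add: frequently_cofinite)
  from infinite_enumerate[OF this] obtain k :: "nat \<Rightarrow> nat"
    where k: "strict_mono k" "\<forall>j. k j \<in> {n. \<exists>P\<in>Q. R n P \<and> P \<notin> V}" by blast
  from k(2) have "\<forall>j. \<exists>P. P \<in> Q \<and> R (k j) P \<and> P \<in> - V" by auto
  then obtain P where P: "\<And>j. P j \<in> Q" "\<And>j. R (k j) (P j)" "\<And>j. P j \<in> - V" by metis
  obtain p i where i: "p \<in> Q" "strict_mono (i :: nat \<Rightarrow> nat)" "(\<lambda>j. P (i j)) \<longlonglongrightarrow> p"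
    using convergent_subsequence[OF Q P(1)] .
  have "p \<in> V"
    by (rule lim[of "\<lambda>j. k (i j)" "\<lambda>j. P (i j)"]) (use k P i in \<open>auto simp: strict_mono_def\<close>)
  moreover have "p \<in> - V"
    by (rule closed_sequentially[OF _ _ i(3)]) (use V P in auto)
  ultimately show False by simp
qed

section \<open>Half-planes in the complement of the limit set\<close>

text \<open>Moving from \<open>w\<close> towards \<open>P\<close>, away from the nearest point
  \<open>y\<close>, the distance to \<open>X\<close> grows at least at unit rate, so
  \<open>A\<close> times it keeps up with the added length.\<close>

lemma carrot_set_away_from_nearest:
  assumes A: "1 \<le> A" and w: "w \<in> carrot_set A X a" and y: "y \<in> X"
    and seg: "w \<in> closed_segment P y" and near: "infdist P X = dist P y"
  shows "P \<in> carrot_set A X a"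
proof -
  obtain L where L: "carrot A 0 X a L w" using w by (auto simp: carrot_set_def)
  have Pwy: "dist P y = dist P w + dist w y"
    using seg by (metis between between_mem_segment)
  have "carrot A 0 X a (L + dist w P) P"
  proof (rule carrot_extend_segment[OF L])
    fix z assume "z \<in> closed_segment w P"
    then have "dist w P = dist w z + dist z P" by (metis between between_mem_segment)
    moreover have "dist P y \<le> infdist z X + dist P z" using infdist_triangle[of P X z] near by simp
    ultimately have "infdist w X + dist w z \<le> infdist z X"
      using Pwy infdist_le[OF y, of w] by (simp add: dist_commute)
    then have "A * (infdist w X + dist w z) \<le> A * infdist z X" using A by (intro mult_left_mono) auto
    moreover have "dist w z \<le> A * dist w z" using A mult_right_mono[of 1 A "dist w z"] by simp
    ultimately show "L + dist w z \<le> A * infdist z X + 0"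
      using carrot_bound[OF L] by (simp add: algebra_simps)
  qed
  then show ?thesis by (rule carrot_setI)
qed

lemma infdist_ge_halfplane:
  fixes z e :: "'a::euclidean_space"
  assumes "Y \<noteq> {}" "norm e \<le> 1" "\<And>y. y \<in> Y \<Longrightarrow> y \<bullet> e \<le> C"
  shows "z \<bullet> e - C \<le> infdist z Y"
proof -
  have "z \<bullet> e - C \<le> dist z y" if "y \<in> Y" for y
  proof -
    have "z \<bullet> e - C \<le> (z - y) \<bullet> e" using assms(3)[OF that] by (simp add: inner_diff_left)
    also have "\<dots> \<le> norm (z - y) * norm e" by (rule norm_cauchy_schwarz)
    also have "\<dots> \<le> dist z y" using mult_left_mono[OF assms(2), of "norm (z - y)"] by (simp add: dist_norm)
    finally show ?thesis .
  qed
  then show ?thesis using assms(1) by (simp add: infdist_notempty cINF_greatest)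
qed

text \<open>If \<open>P\<close> lies deep in the sector around \<open>e\<close>, then moving from \<open>P\<close> in direction \<open>e\<close> increases
  the distance to \<open>Y\<close> at rate at least \<open>1 / A\<close>: for \<open>x = P - y\<close> and \<open>d = infdist P Y\<close>, one has
  \<open>\<bar>x + u e\<bar>\<^sup>2 \<ge> d\<^sup>2 + 2 u d / A + u\<^sup>2 / A\<^sup>2\<close>.\<close>

lemma carrot_ray:
  assumes A: "1 \<le> A" and Y: "0 \<in> Y" and e: "norm e = 1" "\<And>y. y \<in> Y \<Longrightarrow> y \<bullet> e \<le> C"
    and c: "carrot A 0 Y a L P" and P: "norm P \<le> A * (P \<bullet> e - C)" and v: "0 \<le> v"
  shows "carrot A 0 Y a (L + v) (P + v *\<^sub>R e)"
proof (rule carrot_extend[OF c])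
  fix u :: real assume u: "0 \<le> u"
  define d where "d = infdist P Y"
  have "Y \<noteq> {}" using Y by auto
  have d: "0 \<le> d" "d \<le> norm P" "L \<le> A * d"
    using infdist_le[OF Y, of P] carrot_bound[OF c] by (auto simp: d_def infdist_nonneg)
  have "d + u / A \<le> dist (P + u *\<^sub>R e) y" if "y \<in> Y" for y
  proof -
    define x where "x = P - y"
    have "d \<le> norm x" using infdist_le[OF that, of P] by (simp add: d_def x_def dist_norm)
    then have 1: "d\<^sup>2 \<le> (norm x)\<^sup>2" using d(1) by (intro power_mono)
    have "P \<bullet> e - C \<le> x \<bullet> e" using e(2)[OF that] by (simp add: x_def inner_diff_left)
    moreover have "d / A \<le> P \<bullet> e - C" using P d(2) A by (simp add: field_simps)
    ultimately have "u * (d / A) \<le> u * (x \<bullet> e)" using u by (intro mult_left_mono) auto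
    moreover have "(u / A)\<^sup>2 \<le> u\<^sup>2"
      using u A mult_left_mono[of 1 A u] by (intro power_mono) (auto simp: divide_le_eq)
    moreover have "(norm (x + u *\<^sub>R e))\<^sup>2 = (norm x)\<^sup>2 + 2 * (u * (x \<bullet> e)) + u\<^sup>2"
      unfolding power2_norm_eq_inner using e(1)
      by (simp add: inner_simps inner_commute norm_eq_1 power2_eq_square)
    moreover have "(d + u / A)\<^sup>2 = d\<^sup>2 + 2 * (u * (d / A)) + (u / A)\<^sup>2" by (simp add: power2_sum)
    ultimately have "(d + u / A)\<^sup>2 \<le> (norm (x + u *\<^sub>R e))\<^sup>2" using 1 by linarith
    then have "d + u / A \<le> norm (x + u *\<^sub>R e)" by (rule power2_le_imp_le) simp
    then show ?thesis by (simp add: x_def dist_norm algebra_simps)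
  qed
  then have "d + u / A \<le> infdist (P + u *\<^sub>R e) Y"
    using \<open>Y \<noteq> {}\<close> by (simp add: infdist_notempty cINF_greatest)
  then have "A * (d + u / A) \<le> A * infdist (P + u *\<^sub>R e) Y" using A by (intro mult_left_mono) auto
  then show "L + u \<le> A * infdist (P + u *\<^sub>R e) Y + 0" using d(3) A by (simp add: distrib_left)
qed (use e v in auto)

text \<open>Along the ray the left side grows at rate at most 1 and the right side at rate
  \<open>A * (e \<bullet> e')\<close>, which exceeds 1.\<close>

lemma ray_enters_sector:
  fixes P e e' :: "'a::real_inner"
  assumes A: "0 < A" and e: "norm e = 1" and ee': "1 / A < e \<bullet> e'"
  obtains v where "0 \<le> v" "norm (P + v *\<^sub>R e) \<le> A * ((P + v *\<^sub>R e) \<bullet> e' - C)"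
proof -
  have pos: "0 < A * (e \<bullet> e') - 1" using A ee' by (simp add: field_simps)
  define v where "v = \<bar>norm P - A * (P \<bullet> e' - C)\<bar> / (A * (e \<bullet> e') - 1)"
  have "v * (A * (e \<bullet> e') - 1) \<ge> norm P - A * (P \<bullet> e' - C)" using pos by (simp add: v_def)
  moreover have "norm (P + v *\<^sub>R e) \<le> norm P + v"
    using norm_triangle_ineq[of P "v *\<^sub>R e"] pos e by (simp add: v_def)
  ultimately have "norm (P + v *\<^sub>R e) \<le> A * ((P + v *\<^sub>R e) \<bullet> e' - C)"
    by (simp add: inner_simps algebra_simps)
  then show ?thesis using pos by (intro that[of v]) (auto simp: v_def)
qed

text \<open>Both carrots are prolonged by the same \<open>v\<close> in direction \<open>e\<close>.
  Their tips stay at distance \<open>d\<close>, while the clearance from \<open>Y\<close> grows with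
  \<open>v\<close>; as \<open>A > 1\<close>, the first carrot can finally afford the segment to the
  second tip.\<close>

lemma carrot_sets_meet_at_infinity:
  assumes A: "1 < A" and Y: "0 \<in> Y" and e: "norm e = 1" "\<And>y. y \<in> Y \<Longrightarrow> y \<bullet> e \<le> C"
    and P: "P \<in> carrot_set A Y a" "norm P \<le> A * (P \<bullet> e - C)"
    and Q: "Q \<in> carrot_set A Y b" "norm Q \<le> A * (Q \<bullet> e - C)"
  shows "carrot_set A Y a \<inter> carrot_set A Y b \<noteq> {}"
proof -
  obtain L M where L: "carrot A 0 Y a L P" and M: "carrot A 0 Y b M Q"
    using P Q by (auto simp: carrot_set_def)
  define d where "d = dist P Q"
  \<comment> \<open>Chosen so that \<open>L + v + d \<le> A * (P \<bullet> e + v - d - C)\<close>: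
    the total length against the clearance on the joining segment.\<close>
  define v where "v = \<bar>L + d - A * (P \<bullet> e - d - C)\<bar> / (A - 1)"
  have v: "0 \<le> v" "L + d - A * (P \<bullet> e - d - C) \<le> v * (A - 1)" using A by (auto simp: v_def)
  have "carrot A 0 Y a (L + v + dist (P + v *\<^sub>R e) (Q + v *\<^sub>R e)) (Q + v *\<^sub>R e)"
  proof (rule carrot_extend_segment)
    show "carrot A 0 Y a (L + v) (P + v *\<^sub>R e)"
      using carrot_ray[OF _ Y e L P(2) v(1)] A by simp
    fix z assume z: "z \<in> closed_segment (P + v *\<^sub>R e) (Q + v *\<^sub>R e)"
    then have dz: "dist (P + v *\<^sub>R e) z \<le> d"
      using dist_in_closed_segment[OF z] by (simp add: d_def dist_commute)
    have "(P + v *\<^sub>R e - z) \<bullet> e \<le> dist (P + v *\<^sub>R e) z"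
      using norm_cauchy_schwarz[of "P + v *\<^sub>R e - z" e] e(1) by (simp add: dist_norm)
    then have "P \<bullet> e + v - d \<le> z \<bullet> e"
      using dz e(1) by (simp add: inner_simps norm_eq_1)
    then have "P \<bullet> e + v - d - C \<le> infdist z Y"
      using infdist_ge_halfplane[of Y e C z] Y e by force
    then have "A * (P \<bullet> e + v - d - C) \<le> A * infdist z Y" using A by (intro mult_left_mono) auto
    then show "L + v + dist (P + v *\<^sub>R e) z \<le> A * infdist z Y + 0"
      using v(2) dz by (simp add: algebra_simps)
  qed
  moreover have "carrot A 0 Y b (M + v) (Q + v *\<^sub>R e)"
    using carrot_ray[OF _ Y e M Q(2) v(1)] A by simp
  ultimately show ?thesis by (auto intro: carrot_setI)
qed

text \<open>If the distance to \<open>Y\<close> at a far away point \<open>z\<close> is almost \<open>\<bar>z\<bar>\<close>, then \<open>Y\<close> avoids a large disc that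
  looks like a half-plane near the origin.\<close>

lemma far_points_halfplane_direction:
  fixes Y :: "'a::euclidean_space set"
  assumes "0 < \<eta>"
  shows "\<exists>r>0. \<forall>z. r \<le> norm z \<longrightarrow> norm z - C \<le> infdist z Y \<longrightarrow>
    (\<exists>e. norm e = 1 \<and> (\<forall>y\<in>Y. y \<bullet> e \<le> C) \<and> norm (z /\<^sub>R norm z - e) \<le> \<eta>)"
proof (rule ccontr)
  assume no: "\<not> ?thesis"
  have "\<exists>z. real (Suc n) \<le> norm z \<and> norm z - C \<le> infdist z Y \<and>
      (\<forall>e. norm e = 1 \<longrightarrow> (\<forall>y\<in>Y. y \<bullet> e \<le> C) \<longrightarrow> \<eta> < norm (z /\<^sub>R norm z - e))" for n
  proof -
    have "0 < real (Suc n)" by simp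
    then show ?thesis using no by (meson not_le)
  qed
  then obtain z :: "nat \<Rightarrow> 'a" where z: "\<And>n. real (Suc n) \<le> norm (z n)" "\<And>n. norm (z n) - C \<le> infdist (z n) Y"
    "\<And>n e. norm e = 1 \<Longrightarrow> (\<And>y. y \<in> Y \<Longrightarrow> y \<bullet> e \<le> C) \<Longrightarrow> \<eta> < norm (z n /\<^sub>R norm (z n) - e)"
    by metis
  have zpos: "0 < norm (z n)" for n using z(1)[of n] by linarith
  have sph: "\<And>n. z n /\<^sub>R norm (z n) \<in> sphere 0 1" using zpos by simp
  obtain e k where e: "e \<in> sphere 0 1" and k: "strict_mono (k :: nat \<Rightarrow> nat)"
      and lim: "(\<lambda>n. z (k n) /\<^sub>R norm (z (k n))) \<longlonglongrightarrow> e"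
    by (rule convergent_subsequence[OF compact_sphere sph])
  have "y \<bullet> e \<le> C" if y: "y \<in> Y" for y
  proof (rule LIMSEQ_le)
    show "(\<lambda>n. y \<bullet> (z (k n) /\<^sub>R norm (z (k n)))) \<longlonglongrightarrow> y \<bullet> e" by (intro tendsto_intros lim)
    have top: "filterlim (\<lambda>n. norm (z (k n))) at_top sequentially"
    proof (rule filterlim_at_top_mono[OF filterlim_real_sequentially])
      show "\<forall>\<^sub>F n in sequentially. real n \<le> norm (z (k n))"
        using z(1) seq_suble[OF k] by (intro always_eventually allI) (smt (verit) of_nat_Suc of_nat_mono)
    qed
    have "(\<lambda>n. C + ((norm y)\<^sup>2 - C\<^sup>2) / 2 * inverse (norm (z (k n)))) \<longlonglongrightarrow> C + ((norm y)\<^sup>2 - C\<^sup>2) / 2 * 0"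
      by (intro tendsto_intros tendsto_inverse_0_at_top[OF top])
    then show "(\<lambda>n. C + ((norm y)\<^sup>2 - C\<^sup>2) / 2 * inverse (norm (z (k n)))) \<longlonglongrightarrow> C" by simp
    have "\<forall>\<^sub>F n in sequentially. C \<le> norm (z (k n))"
      using top by (simp add: filterlim_at_top)
    then obtain N where N: "\<And>n. n \<ge> N \<Longrightarrow> C \<le> norm (z (k n))" by (auto simp: eventually_sequentially)
    have "y \<bullet> (z (k n) /\<^sub>R norm (z (k n))) \<le> C + ((norm y)\<^sup>2 - C\<^sup>2) / 2 * inverse (norm (z (k n)))"
      if "n \<ge> N" for n
    proof -
      define w where "w = z (k n)"
      have w: "0 < norm w" "C \<le> norm w" "norm w - C \<le> dist w y"
        using N[OF that] zpos[of "k n"] z(2)[of "k n"] infdist_le[OF y, of w] by (auto simp: w_def)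
      \<comment> \<open>Squaring cancels the quadratic term in \<open>w\<close>; division by
        \<open>norm w\<close> leaves an error that vanishes at infinity. Squaring is legitimate only
        once \<open>C \<le> norm w\<close>, hence \<open>N\<close>.\<close>
      have "(norm w - C)\<^sup>2 \<le> (norm (w - y))\<^sup>2" using w by (intro power_mono) (auto simp: dist_norm)
      also have "(norm (w - y))\<^sup>2 = (norm w)\<^sup>2 - 2 * (y \<bullet> w) + (norm y)\<^sup>2"
        by (simp add: power2_norm_eq_inner inner_simps inner_commute)
      finally have "y \<bullet> w \<le> C * norm w + ((norm y)\<^sup>2 - C\<^sup>2) / 2" unfolding power2_diff by argo
      then have "(y \<bullet> w) / norm w \<le> (C * norm w + ((norm y)\<^sup>2 - C\<^sup>2) / 2) / norm w"
        using w by (intro divide_right_mono) auto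
      also have "\<dots> = C + ((norm y)\<^sup>2 - C\<^sup>2) / 2 * inverse (norm w)"
        using w by (simp add: field_simps)
      finally have "(y \<bullet> w) / norm w \<le> C + ((norm y)\<^sup>2 - C\<^sup>2) / 2 * inverse (norm w)" .
      moreover have "y \<bullet> (w /\<^sub>R norm w) = (y \<bullet> w) / norm w"
        unfolding inner_scaleR_right divide_inverse by (rule mult.commute)
      ultimately show ?thesis unfolding w_def by argo
    qed
    then show "\<exists>N. \<forall>n\<ge>N. y \<bullet> (z (k n) /\<^sub>R norm (z (k n))) \<le> C + ((norm y)\<^sup>2 - C\<^sup>2) / 2 * inverse (norm (z (k n)))"
      by blast
  qed
  then have far: "\<eta> < norm (z (k n) /\<^sub>R norm (z (k n)) - e)" for n using z(3)[of e] e by simp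
  have "(\<lambda>n. norm (z (k n) /\<^sub>R norm (z (k n)) - e)) \<longlonglongrightarrow> norm (e - e)"
    by (intro tendsto_intros lim)
  then have "\<eta> \<le> norm (e - e)" by (rule LIMSEQ_le_const) (use far less_imp_le in blast)
  then show False using assms by simp
qed

text \<open>Each of \<open>W\<close> and \<open>E - W\<close> is \<open>E\<close> without the open
  \<open>\<delta>\<close>-balls around the points of the other.\<close>

lemma clopen_in_of_uniform_gap:
  fixes E W :: "'a::metric_space set"
  assumes "closed E" "W \<subseteq> E" "0 < \<delta>" and gap: "\<And>e e'. e \<in> W \<Longrightarrow> e' \<in> E \<Longrightarrow> dist e e' < \<delta> \<Longrightarrow> e' \<in> W"
  shows "closed W" "closed (E - W)"
proof -
  have "W = E - (\<Union>e\<in>E - W. ball e \<delta>)"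
  proof (intro equalityI subsetI DiffI)
    fix w assume w: "w \<in> W"
    then show "w \<in> E" using assms(2) by blast
    show "w \<notin> (\<Union>e\<in>E - W. ball e \<delta>)" using gap[OF w] by (auto simp: dist_commute)
  next
    fix w assume "w \<in> E - (\<Union>e\<in>E - W. ball e \<delta>)"
    then show "w \<in> W" using assms(3) by (auto dest!: bspec[of _ _ w])
  qed
  then show "closed W" using assms(1) by (metis closed_Diff open_UN open_ball)
  have "E - W = E - (\<Union>e\<in>W. ball e \<delta>)"
  proof (intro equalityI subsetI DiffI)
    fix w assume w: "w \<in> E - W"
    then show "w \<in> E" by blast
    show "w \<notin> (\<Union>e\<in>W. ball e \<delta>)" using gap w by auto
  next
    fix w assume "w \<in> E - (\<Union>e\<in>W. ball e \<delta>)"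
    then show "w \<in> E" "w \<notin> W" using assms(3) by (auto dest!: bspec[of _ _ w])
  qed
  then show "closed (E - W)" using assms(1) by (metis closed_Diff open_UN open_ball)
qed

section \<open>Limits of simply connected John domains\<close>

text \<open>The base points are normalised to 0, and convergence of the boundaries is convergence of
  their distance functions. As \<open>z0\<close> lies in \<open>D n\<close> only for infinitely many
  \<open>n\<close>, compact pieces of \<open>U\<close> are in \<open>D n\<close> frequently, not
  eventually.\<close>

locale converging_domains =
  fixes A :: real and D :: "nat \<Rightarrow> complex set" and Y U :: "complex set" and z0 :: complex
  assumes A: "1 \<le> A"
    and open_D: "\<And>n. open (D n)" and simply_connected_D: "\<And>n. simply_connected (D n)"
    and zero_frontier: "\<And>n. 0 \<in> frontier (D n)"
    and closed_Y: "closed Y" and zero_Y: "0 \<in> Y"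
    and conv: "\<And>z. (\<lambda>n. infdist z (frontier (D n))) \<longlonglongrightarrow> infdist z Y"
    and carrots: "\<And>n a b. a \<in> D n \<Longrightarrow> b \<in> D n \<Longrightarrow> \<exists>Sa Sb m. compact Sa \<and> connected Sa \<and> compact Sb \<and>
      connected Sb \<and> Sa \<subseteq> D n \<and> Sb \<subseteq> D n \<and> a \<in> Sa \<and> b \<in> Sb \<and> m \<in> Sa \<and> m \<in> Sb \<and>
      Sa \<subseteq> carrot_set A (frontier (D n)) a \<and> Sb \<subseteq> carrot_set A (frontier (D n)) b"
    and U: "U \<in> components (- Y)" and z0: "z0 \<in> U" and frequently_z0: "\<exists>\<^sub>F n in sequentially. z0 \<in> D n"
begin

lemma A_nonneg: "0 \<le> A"
  using A by simp

lemma conv_subseq: "strict_mono k \<Longrightarrow> (\<lambda>j. infdist z (frontier (D (k j)))) \<longlonglongrightarrow> infdist z Y"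
  using LIMSEQ_subseq_LIMSEQ[OF conv, of k z] by (simp add: comp_def)

lemma U_subset: "U \<subseteq> - Y"
  using U by (rule in_components_subset)

lemma U_connected_extend: "connected S \<Longrightarrow> S \<inter> Y = {} \<Longrightarrow> S \<inter> U \<noteq> {} \<Longrightarrow> S \<subseteq> U"
  by (rule components_maximal[OF U]) auto

lemma open_U: "open U"
  by (rule open_components[OF _ U]) (use closed_Y in \<open>simp add: open_Compl\<close>)

lemma compact_connected_in_U:
  assumes "a \<in> U" "b \<in> U"
  obtains K where "compact K" "connected K" "K \<subseteq> U" "a \<in> K" "b \<in> K" "z0 \<in> K"
proof -
  have "path_connected U"
    using open_U U by (simp add: connected_open_path_connected in_components_connected)
  then obtain g h where g: "path g" "path_image g \<subseteq> U" "pathstart g = z0" "pathfinish g = a"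
    and h: "path h" "path_image h \<subseteq> U" "pathstart h = z0" "pathfinish h = b"
    using assms z0 unfolding path_connected_def by metis
  have "z0 \<in> path_image g" "z0 \<in> path_image h" "a \<in> path_image g" "b \<in> path_image h"
    using g h pathstart_in_path_image pathfinish_in_path_image by metis+
  then show ?thesis using g h
    by (intro that[of "path_image g \<union> path_image h"] connected_Un) auto
qed

text \<open>The boundaries converge to \<open>Y\<close>, which \<open>K\<close> misses, so they
  eventually miss \<open>K\<close>; a connected set off the boundary with one point in
  \<open>D n\<close> lies in \<open>D n\<close>.\<close>

lemma eventually_subset_D:
  assumes K: "compact K" "connected K" "K \<subseteq> U" "z0 \<in> K"
  shows "\<forall>\<^sub>F n in sequentially. z0 \<in> D n \<longrightarrow> K \<subseteq> D n"
proof -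
  \<comment> \<open>With \<open>V = {}\<close> the compactness principle says that eventually no
    such \<open>P\<close> exists.\<close>
  have "\<forall>\<^sub>F n in sequentially. \<forall>P\<in>K. infdist P (frontier (D n)) \<le> 0 \<longrightarrow> P \<in> {}"
  proof (rule eventually_on_compact[OF K(1) open_empty])
    fix k P p assume k: "strict_mono (k :: nat \<Rightarrow> nat)" "P \<longlonglongrightarrow> p" "p \<in> K"
      and le: "\<And>j. infdist (P j) (frontier (D (k j))) \<le> 0"
    have "infdist p Y \<le> 0"
      by (rule LIMSEQ_le_const2[OF infdist_tendsto_moving[OF conv_subseq[OF k(1)] k(2)]])
        (use le in auto)
    then have "p \<in> Y" using in_closed_iff_infdist_zero[OF closed_Y, of p] zero_Y infdist_nonneg[of p Y]
      by fastforce
    then show "p \<in> {}" using k(3) K(3) U_subset by auto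
  qed
  then show ?thesis
  proof eventually_elim
    case (elim n)
    have "K \<inter> frontier (D n) = {}" using elim by force
    then show ?case using connected_Int_frontier[OF K(2), of "D n"] K(4) by blast
  qed
qed

lemma frequently_subset_D:
  assumes "compact K" "connected K" "K \<subseteq> U" "z0 \<in> K"
  shows "\<exists>\<^sub>F n in sequentially. K \<subseteq> D n"
  using frequently_eventually_frequently[OF frequently_z0 eventually_subset_D[OF assms]]
  by (rule frequently_elim1) auto

lemma eventually_carrot_set_subset:
  assumes "compact Q" "open V" "Q \<inter> carrot_set A Y a \<subseteq> V"
  shows "\<forall>\<^sub>F n in sequentially. \<forall>P\<in>Q. P \<in> carrot_set A (frontier (D n)) a \<longrightarrow> P \<in> V"
proof (rule eventually_on_compact[OF assms(1,2)])
  fix k P p assume k: "strict_mono (k :: nat \<Rightarrow> nat)" "P \<longlonglongrightarrow> p" "p \<in> Q"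
    and "\<And>j. P j \<in> carrot_set A (frontier (D (k j))) a"
  then have "\<forall>j. \<exists>L. carrot A 0 (frontier (D (k j))) a L (P j)" by (auto simp: carrot_set_def)
  then obtain L where "\<And>j. carrot A 0 (frontier (D (k j))) a (L j) (P j)" by metis
  then have "p \<in> carrot_set A Y a"
    by (intro carrot_limit[OF A_nonneg conv_subseq[OF k(1)] k(2), of "\<lambda>_. 0"]) auto
  then show "p \<in> V" using assms(3) k(3) by auto
qed

text \<open>These are the inner normals of half-planes \<open>z \<bullet> e > C\<close> that are
  disjoint from \<open>Y\<close>.\<close>

definition halfplane_dirs :: "real \<Rightarrow> complex set" where
  "halfplane_dirs C = {e. norm e = 1 \<and> (\<forall>y\<in>Y. y \<bullet> e \<le> C)}"

lemma compact_halfplane_dirs: "compact (halfplane_dirs C)"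
proof -
  have "halfplane_dirs C = sphere 0 1 \<inter> (\<Inter>y\<in>Y. {e. y \<bullet> e \<le> C})"
    by (auto simp: halfplane_dirs_def)
  then show ?thesis by (auto intro!: compact_Int_closed closed_INT closed_Collect_le continuous_intros)
qed

text \<open>The directions in which carrots from \<open>a\<close> can escape to infinity inside a half-plane that avoids \<open>Y\<close>.\<close>

definition escape_dirs :: "real \<Rightarrow> complex \<Rightarrow> complex set" where
  "escape_dirs C a = {e \<in> halfplane_dirs C. \<exists>P\<in>carrot_set A Y a. norm P \<le> A * (P \<bullet> e - C)}"

text \<open>A carrot that escapes along \<open>e\<close> is continued straight in direction
  \<open>e\<close> until it has entered the sector around \<open>e'\<close>.\<close>

lemma escape_dirs_near:
  assumes e: "e \<in> escape_dirs C a" and e': "e' \<in> halfplane_dirs C" and "1 / A < e \<bullet> e'"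
  shows "e' \<in> escape_dirs C a"
proof -
  obtain P L where P: "carrot A 0 Y a L P" "norm P \<le> A * (P \<bullet> e - C)"
    and e1: "norm e = 1" "\<And>y. y \<in> Y \<Longrightarrow> y \<bullet> e \<le> C"
    using e by (auto simp: escape_dirs_def carrot_set_def halfplane_dirs_def)
  obtain v where v: "0 \<le> v" "norm (P + v *\<^sub>R e) \<le> A * ((P + v *\<^sub>R e) \<bullet> e' - C)"
    using ray_enters_sector[OF _ e1(1) assms(3)] A by auto
  have "P + v *\<^sub>R e \<in> carrot_set A Y a"
    by (rule carrot_setI[OF carrot_ray[OF A zero_Y e1 P v(1)]])
  then show ?thesis using v(2) e' by (auto simp: escape_dirs_def)
qed

lemma carrot_sets_meet_if_gt_1:
  assumes A1: "1 < A" and ab: "a \<in> U" "b \<in> U"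
  shows "carrot_set A Y a \<inter> carrot_set A Y b \<noteq> {}"
proof
  assume disj: "carrot_set A Y a \<inter> carrot_set A Y b = {}"
  obtain K where K: "compact K" "connected K" "K \<subseteq> U" "a \<in> K" "b \<in> K" "z0 \<in> K"
    using compact_connected_in_U[OF ab] .
  obtain C where C: "0 < C" "K \<subseteq> ball 0 C"
    using bounded_subset_ballD[OF compact_imp_bounded[OF K(1)]] by blast
  \<comment> \<open>Unit vectors at distance at most \<open>2 * \<eta>\<close> have inner product at
    least \<open>(1 + 1 / A) / 2\<close>, which exceeds \<open>1 / A\<close>. The factor 2 allows
    for two directions that are both \<open>\<eta>\<close>-close to the same point.\<close>
  define \<eta> where "\<eta> = sqrt ((1 - 1 / A) / 4)"
  have \<eta>2: "\<eta>\<^sup>2 = (1 - 1 / A) / 4" and \<eta>: "0 < \<eta>" using A1 by (auto simp: \<eta>_def)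
  have inner_dist: "x \<bullet> y = 1 - (dist x y)\<^sup>2 / 2" if "norm x = 1" "norm y = 1" for x y :: complex
    using that by (simp add: dot_norm_neg dist_norm)
  have close_dirs: "1 / A < x \<bullet> y" if "norm x = 1" "norm y = 1" "dist x y \<le> 2 * \<eta>" for x y :: complex
  proof -
    have "(dist x y)\<^sup>2 \<le> (2 * \<eta>)\<^sup>2" using that by (intro power_mono) auto
    then have "(dist x y)\<^sup>2 \<le> 1 - 1 / A" by (simp add: power_mult_distrib \<eta>2)
    moreover have "1 / A < 1" using A1 by simp
    ultimately show ?thesis using inner_dist[OF that(1,2)] by linarith
  qed
  define E where "E = halfplane_dirs C"
  define Wa where "Wa = escape_dirs C a"
  define Wb where "Wb = escape_dirs C b"
  have E: "closed E" "\<And>e. e \<in> E \<Longrightarrow> norm e = 1"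
    using compact_halfplane_dirs[of C] by (auto simp: E_def compact_imp_closed halfplane_dirs_def)
  have W_sub: "Wa \<subseteq> E" "Wb \<subseteq> E" by (auto simp: Wa_def Wb_def E_def escape_dirs_def)
  have Wab: "Wa \<inter> Wb = {}"
  proof (rule ccontr)
    assume "Wa \<inter> Wb \<noteq> {}"
    then obtain e where "e \<in> escape_dirs C a" "e \<in> escape_dirs C b" by (auto simp: Wa_def Wb_def)
    then show False using carrot_sets_meet_at_infinity[OF A1 zero_Y, of e C _ a _ b] disj
      by (auto simp: escape_dirs_def halfplane_dirs_def)
  qed
  have Wa_near: "e' \<in> Wa" if "e \<in> Wa" "e' \<in> E" "dist e e' \<le> 2 * \<eta>" for e e'
    using escape_dirs_near[of e C a e'] close_dirs[of e e'] that W_sub E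
    by (auto simp: Wa_def E_def)
  have W_closed: "closed Wa" "closed (E - Wa)"
    using clopen_in_of_uniform_gap[OF E(1) W_sub(1), of "2 * \<eta>"] \<eta> Wa_near by force+
  have W_compact: "compact Wa" "compact (E - Wa)"
    using compact_halfplane_dirs[of C] W_closed W_sub
    by (auto simp: E_def compact_eq_bounded_closed intro: bounded_subset)
  obtain r0 where r0: "0 < r0" "\<And>z. r0 \<le> norm z \<Longrightarrow> norm z - C \<le> infdist z Y \<Longrightarrow>
    \<exists>e\<in>E. norm (z /\<^sub>R norm z - e) \<le> \<eta>"
    using far_points_halfplane_direction[OF \<eta>, of C Y] unfolding E_def halfplane_dirs_def by blast
  \<comment> \<open>\<open>r0\<close> makes far points have half-plane directions, \<open>C\<close>
    puts \<open>K\<close> inside the circle, and the last term absorbs the loss \<open>A * C\<close>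
    in \<open>sector\<close>.\<close>
  define r where "r = max r0 (max C (2 * A * C / (A - 1)))"
  have r: "r0 \<le> r" "C \<le> r" "0 < r" "2 * A * C \<le> r * (A - 1)"
  proof -
    show "r0 \<le> r" "C \<le> r" "0 < r" using C by (auto simp: r_def)
    have "2 * A * C / (A - 1) \<le> r" by (simp add: r_def)
    then show "2 * A * C \<le> r * (A - 1)" using A1 by (simp add: divide_le_eq)
  qed
  \<comment> \<open>On the circle, closeness to \<open>e\<close> already implies membership in its
    escape sector, so a carrot tip there makes \<open>e\<close> an escape direction.\<close>
  have sector: "norm z \<le> A * (z \<bullet> e - C)" if "norm z = r" "norm e = 1" "norm (z /\<^sub>R r - e) \<le> \<eta>" for z e :: complex
  proof -
    have n1: "norm (z /\<^sub>R r) = 1" using that r by simp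
    have "(dist (z /\<^sub>R r) e)\<^sup>2 \<le> \<eta>\<^sup>2" using that by (intro power_mono) (auto simp: dist_norm)
    then have "1 - (1 - 1 / A) / 8 \<le> (z /\<^sub>R r) \<bullet> e" using inner_dist[OF n1 that(2)] \<eta>2 by simp
    then have "r * (1 - (1 - 1 / A) / 8) \<le> r * ((z /\<^sub>R r) \<bullet> e)" using r(3) by (intro mult_left_mono) auto
    also have "\<dots> = z \<bullet> e" using r(3) by simp
    finally have "A * (r * (1 - (1 - 1 / A) / 8)) \<le> A * (z \<bullet> e)" using A by (intro mult_left_mono) auto
    moreover have "A * (r * (1 - (1 - 1 / A) / 8)) = r + 7 / 8 * (r * (A - 1))" using A1 by (simp add: field_simps)
    moreover have "0 \<le> A * C" using A C by simp
    moreover have "A * (z \<bullet> e - C) = A * (z \<bullet> e) - A * C" by (simp add: right_diff_distrib)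
    ultimately show ?thesis using r(4) that(1) by linarith
  qed
  define Q where "Q = sphere (0::complex) r"
  define Near where "Near W = {z. \<exists>e\<in>W. norm (z /\<^sub>R r - e) \<le> \<eta>}" for W :: "complex set"
  have closed_Near: "closed (Near W)" if "compact W" for W
  proof -
    have "Near W = (\<lambda>z. z /\<^sub>R r) -` (\<Union>x\<in>cball 0 \<eta>. \<Union>e\<in>W. {x + e})"
    proof -
      have "(\<exists>e\<in>W. norm (w - e) \<le> \<eta>) \<longleftrightarrow> w \<in> (\<Union>x\<in>cball 0 \<eta>. \<Union>e\<in>W. {x + e})" for w
      proof
        assume "\<exists>e\<in>W. norm (w - e) \<le> \<eta>"
        then obtain e where "e \<in> W" "w - e \<in> cball 0 \<eta>" "w = (w - e) + e" by auto
        then show "w \<in> (\<Union>x\<in>cball 0 \<eta>. \<Union>e\<in>W. {x + e})" by blast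
      next
        assume "w \<in> (\<Union>x\<in>cball 0 \<eta>. \<Union>e\<in>W. {x + e})"
        then obtain x e where "norm x \<le> \<eta>" "e \<in> W" "w - e = x" by auto
        then show "\<exists>e\<in>W. norm (w - e) \<le> \<eta>" by metis
      qed
      then show ?thesis by (auto simp: Near_def)
    qed
    moreover have "closed (\<Union>x\<in>cball 0 \<eta>. \<Union>e\<in>W. {x + e})" by (intro closed_compact_sums that) auto
    ultimately show ?thesis by (auto intro!: closed_vimage continuous_intros)
  qed
  \<comment> \<open>The directions in which neither carrot escapes must join one side; they are put
    with \<open>b\<close>, so \<open>Fb\<close> uses \<open>E - Wa\<close> instead of
    \<open>Wb\<close>.\<close>
  define Fa where "Fa = Q \<inter> (carrot_set A Y a \<union> ({z. r - C \<le> infdist z Y} \<inter> Near Wa))"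
  define Fb where "Fb = Q \<inter> (carrot_set A Y b \<union> ({z. r - C \<le> infdist z Y} \<inter> Near (E - Wa)))"
  have cl_far: "closed {z. r - C \<le> infdist z Y}" by (intro closed_Collect_le continuous_intros)
  have F_closed: "closed Fa" "closed Fb" unfolding Fa_def Fb_def Q_def
    by (intro closed_Int closed_Un closed_carrot_set closed_Near W_compact cl_far closed_sphere A_nonneg)+
  have F_disj: "Fa \<inter> Fb = {}"
  proof (rule ccontr)
    assume "Fa \<inter> Fb \<noteq> {}"
    then obtain z where "z \<in> Fa" "z \<in> Fb" by blast
    then have z: "norm z = r" "z \<in> carrot_set A Y a \<or> z \<in> Near Wa"
      "z \<in> carrot_set A Y b \<or> z \<in> Near (E - Wa)" by (auto simp: Fa_def Fb_def Q_def)
    consider "z \<in> carrot_set A Y a" "z \<in> carrot_set A Y b"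
      | e where "z \<in> carrot_set A Y a" "e \<in> E - Wa" "norm (z /\<^sub>R r - e) \<le> \<eta>"
      | e where "z \<in> carrot_set A Y b" "e \<in> Wa" "norm (z /\<^sub>R r - e) \<le> \<eta>"
      | e e' where "e \<in> Wa" "norm (z /\<^sub>R r - e) \<le> \<eta>" "e' \<in> E - Wa" "norm (z /\<^sub>R r - e') \<le> \<eta>"
      using z(2,3) by (auto simp: Near_def)
    then show False
    proof cases
      case 1
      then show False using disj by blast
    next
      case 2
      then have "e \<in> Wa" using sector[OF z(1), of e] E(2)[of e] by (auto simp: Wa_def escape_dirs_def E_def)
      then show False using 2 by simp
    next
      case 3
      then have "e \<in> Wb" using sector[OF z(1), of e] E(2)[of e] W_sub(1)
        by (auto simp: Wb_def escape_dirs_def E_def)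
      then show False using 3 Wab by blast
    next
      case 4
      have "dist e e' \<le> norm (z /\<^sub>R r - e) + norm (z /\<^sub>R r - e')"
        using dist_triangle[of e e' "z /\<^sub>R r"] by (simp add: dist_norm norm_minus_commute)
      then have "e' \<in> Wa" using 4 by (intro Wa_near[of e e']) auto
      then show False using 4 by simp
    qed
  qed
  obtain Oa Ob where O: "open Oa" "open Ob" "Fa \<subseteq> Oa" "Fb \<subseteq> Ob" "Oa \<inter> Ob = {}"
    using separation_normal[OF F_closed F_disj] .
  have closed_ball: "closed (carrot_set A Y c \<inter> cball 0 r)" for c
    by (intro closed_Int closed_carrot_set A_nonneg closed_cball)
  have disj_ball: "(carrot_set A Y a \<inter> cball 0 r) \<inter> (carrot_set A Y b \<inter> cball 0 r) = {}"
    using disj by blast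
  \<comment> \<open>These neighbourhoods force the common tip \<open>m\<close> of the approximating
    carrots out of \<open>cball 0 r\<close>.\<close>
  obtain Va Vb where V: "open Va" "open Vb" "carrot_set A Y a \<inter> cball 0 r \<subseteq> Va"
    "carrot_set A Y b \<inter> cball 0 r \<subseteq> Vb" "Va \<inter> Vb = {}"
    using separation_normal[OF closed_ball closed_ball disj_ball] .
  have "\<forall>\<^sub>F n in sequentially. \<forall>P\<in>Q. P \<in> carrot_set A (frontier (D n)) a \<longrightarrow> P \<in> Oa"
    using O by (intro eventually_carrot_set_subset) (auto simp: Q_def Fa_def)
  moreover have "\<forall>\<^sub>F n in sequentially. \<forall>P\<in>Q. P \<in> carrot_set A (frontier (D n)) b \<longrightarrow> P \<in> Ob"
    using O by (intro eventually_carrot_set_subset) (auto simp: Q_def Fb_def)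
  moreover have "\<forall>\<^sub>F n in sequentially. \<forall>P\<in>cball 0 r. P \<in> carrot_set A (frontier (D n)) a \<longrightarrow> P \<in> Va"
    using V by (intro eventually_carrot_set_subset) auto
  moreover have "\<forall>\<^sub>F n in sequentially. \<forall>P\<in>cball 0 r. P \<in> carrot_set A (frontier (D n)) b \<longrightarrow> P \<in> Vb"
    using V by (intro eventually_carrot_set_subset) auto
  moreover have "\<forall>\<^sub>F n in sequentially. \<forall>P\<in>Q. r - C \<le> infdist P (frontier (D n)) \<longrightarrow> P \<in> Oa \<union> Ob"
  proof (rule eventually_on_compact)
    fix k P p assume k: "strict_mono (k :: nat \<Rightarrow> nat)" "P \<longlonglongrightarrow> p" "p \<in> Q"
      and ge: "\<And>j. r - C \<le> infdist (P j) (frontier (D (k j)))"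
    have far: "r - C \<le> infdist p Y"
      by (rule LIMSEQ_le_const[OF infdist_tendsto_moving[OF conv_subseq[OF k(1)] k(2)]]) (use ge in auto)
    have "norm p = r" using k(3) by (simp add: Q_def)
    then obtain e where "e \<in> E" "norm (p /\<^sub>R r - e) \<le> \<eta>" using r0(2)[of p] far r by auto
    then have "p \<in> Near Wa \<or> p \<in> Near (E - Wa)" by (auto simp: Near_def)
    then show "p \<in> Oa \<union> Ob" using far k(3) O by (auto simp: Fa_def Fb_def)
  qed (use O in \<open>auto simp: Q_def\<close>)
  ultimately have "\<forall>\<^sub>F n in sequentially. K \<subseteq> D n \<longrightarrow> False"
  proof eventually_elim
    case (elim n)
    show ?case
    proof
      assume KD: "K \<subseteq> D n"
      then obtain Sa Sb m where S: "compact Sa" "connected Sa" "compact Sb" "connected Sb" "Sa \<subseteq> D n" "Sb \<subseteq> D n"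
        "a \<in> Sa" "b \<in> Sb" "m \<in> Sa" "m \<in> Sb"
        "Sa \<subseteq> carrot_set A (frontier (D n)) a" "Sb \<subseteq> carrot_set A (frontier (D n)) b"
        using carrots[of a n b] K by blast
      \<comment> \<open>The filled hull of this closed chain is the region \<open>H\<close> without
        holes to which the separation lemma applies, with \<open>T = K\<close>.\<close>
      define J where "J = Sa \<union> Sb \<union> K"
      have J: "compact J" "J \<subseteq> D n" using S K KD by (auto simp: J_def)
      show False
      proof (rule no_crossing_separation[OF compact_filled_hull[OF J(1)], of Sa Sb K a b m r Oa Ob])
        show "r < norm m"
        proof (rule ccontr)
          assume "\<not> r < norm m"
          then have "m \<in> cball 0 r" by simp
          then have "m \<in> Va" "m \<in> Vb" using elim(3,4) S by blast+
          then show False using V(5) by blast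
        qed
        show "(J \<union> inside J) \<inter> sphere 0 r \<subseteq> Oa \<union> Ob"
        proof
          fix P assume P: "P \<in> (J \<union> inside J) \<inter> sphere 0 r"
          then have PQ: "P \<in> Q" "norm P = r" by (auto simp: Q_def)
          obtain w y where w: "w \<in> J" "y \<in> frontier (D n)" "w \<in> closed_segment P y"
            "infdist P (frontier (D n)) = dist P y"
            using nearest_boundary_segment_meets[OF open_D simply_connected_D J(2) compact_imp_closed[OF J(1)], of P]
              P zero_frontier[of n] by blast
          from w(1) consider "w \<in> Sa" | "w \<in> Sb" | "w \<in> K" by (auto simp: J_def)
          then show "P \<in> Oa \<union> Ob"
          proof cases
            case 1
            then have "P \<in> carrot_set A (frontier (D n)) a"
              using carrot_set_away_from_nearest[OF A _ w(2-4)] S by blast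
            then show ?thesis using elim(1) PQ by blast
          next
            case 2
            then have "P \<in> carrot_set A (frontier (D n)) b"
              using carrot_set_away_from_nearest[OF A _ w(2-4)] S by blast
            then show ?thesis using elim(2) PQ by blast
          next
            case 3
            then have "norm w < C" using C by auto
            then have "r - C \<le> dist P w" using norm_triangle_ineq2[of P w] PQ by (simp add: dist_norm)
            also have "\<dots> \<le> dist P y"
              using dist_in_closed_segment[OF w(3)] by (simp add: dist_commute)
            finally show ?thesis using elim(5) PQ w(4) by auto
          qed
        qed
        show "Sa \<inter> sphere 0 r \<subseteq> Oa" "Sb \<inter> sphere 0 r \<subseteq> Ob" using elim(1,2) S by (auto simp: Q_def)
        show "K \<subseteq> ball 0 r" using C r by auto
      qed (use S K O in \<open>auto simp: J_def\<close>)
    qed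
  qed
  from frequently_ex[OF frequently_eventually_conj[OF frequently_subset_D[OF K(1-3,6)] this]]
  show False by blast
qed

end

section \<open>The case of constant 1: discs, half-planes and convexity\<close>

lemma norm_power2_add: "(norm (x + y))\<^sup>2 = (norm x)\<^sup>2 + 2 * (x \<bullet> y) + (norm y)\<^sup>2" for x y :: "'a::real_inner"
  by (simp add: power2_norm_eq_inner inner_simps inner_commute)

text \<open>The distance to \<open>Y\<close> drops from \<open>m\<close> towards \<open>a\<close> at
  rate at most 1, exactly as fast as the remaining length, so the straight segment is a
  carrot.\<close>

lemma carrot_set_of_dist_le:
  assumes "dist a m \<le> infdist m Y"
  shows "m \<in> carrot_set 1 Y a"
proof -
  have "carrot 1 0 Y a (0 + dist a m) m"
  proof (rule carrot_extend_segment[OF carrot_refl])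
    fix z assume "z \<in> closed_segment a m"
    then have "dist a m = dist a z + dist z m" by (metis between between_mem_segment)
    then show "0 + dist a z \<le> 1 * infdist z Y + 0"
      using assms infdist_triangle[of m Y z] by (simp add: dist_commute)
  qed auto
  then show ?thesis by (rule carrot_setI)
qed

text \<open>Discs centred at \<open>m j\<close> through \<open>a\<close> become a half-plane as the
  centres escape in direction \<open>e\<close>: squaring the inequality cancels the square of
  \<open>norm (m j)\<close>, and division by \<open>norm (m j)\<close> leaves a linear condition in
  the limit.\<close>

lemma horofunction_limit:
  fixes a y e :: "'a::real_inner"
  assumes le: "\<And>j. dist a (m j) \<le> dist (m j) (w j)" and w: "w \<longlonglongrightarrow> y"
    and top: "filterlim (\<lambda>j. norm (m j)) at_top sequentially"
    and e: "(\<lambda>j. m j /\<^sub>R norm (m j)) \<longlonglongrightarrow> e"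
  shows "y \<bullet> e \<le> a \<bullet> e"
proof -
  have lim_l: "(\<lambda>j. (w j - a) \<bullet> (m j /\<^sub>R norm (m j))) \<longlonglongrightarrow> (y - a) \<bullet> e" by (intro tendsto_intros w e)
  have lim_r: "(\<lambda>j. ((norm (w j))\<^sup>2 - (norm a)\<^sup>2) / 2 * inverse (norm (m j))) \<longlonglongrightarrow> ((norm y)\<^sup>2 - (norm a)\<^sup>2) / 2 * 0"
    by (intro tendsto_intros w tendsto_inverse_0_at_top[OF top]) simp
  have "(w j - a) \<bullet> (m j /\<^sub>R norm (m j)) \<le> ((norm (w j))\<^sup>2 - (norm a)\<^sup>2) / 2 * inverse (norm (m j))" for j
  proof -
    have "(dist a (m j))\<^sup>2 \<le> (dist (m j) (w j))\<^sup>2" by (intro power_mono le) auto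
    then have "(w j - a) \<bullet> m j \<le> ((norm (w j))\<^sup>2 - (norm a)\<^sup>2) / 2"
      by (simp add: dist_norm power2_norm_eq_inner inner_simps inner_commute)
    then have "(w j - a) \<bullet> m j * inverse (norm (m j))
        \<le> ((norm (w j))\<^sup>2 - (norm a)\<^sup>2) / 2 * inverse (norm (m j))" by (rule mult_right_mono) simp
    then show ?thesis by (simp add: mult.commute)
  qed
  then have "(y - a) \<bullet> e \<le> ((norm y)\<^sup>2 - (norm a)\<^sup>2) / 2 * 0"
    by (intro LIMSEQ_le[OF lim_l lim_r]) blast
  then show ?thesis by (simp add: inner_diff_left)
qed

context converging_domains
begin

lemma exists_center:
  assumes "A = 1" "a \<in> D n" "b \<in> D n"
  obtains m where "dist a m \<le> infdist m (frontier (D n))" "dist b m \<le> infdist m (frontier (D n))"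
proof -
  obtain m where "m \<in> carrot_set A (frontier (D n)) a" "m \<in> carrot_set A (frontier (D n)) b"
    using carrots[OF assms(2,3)] by blast
  then obtain L M where L: "carrot A 0 (frontier (D n)) a L m" and M: "carrot A 0 (frontier (D n)) b M m"
    by (auto simp: carrot_set_def)
  show ?thesis
    using carrot_dist[OF L] carrot_bound[OF L] carrot_dist[OF M] carrot_bound[OF M] assms(1)
    by (intro that[of m]) auto
qed

text \<open>A disc whose interior misses the frontier and whose closure contains
  \<open>y + h\<close> and \<open>y - h\<close> has \<open>y\<close> strictly inside: by the
  parallelogram law the midpoint is closer to the centre than one of the two ends.\<close>

lemma midpoint_notin_frontier:
  assumes "A = 1" "y + h \<in> D n" "y - h \<in> D n" "h \<noteq> 0"
  shows "y \<notin> frontier (D n)"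
proof
  assume y: "y \<in> frontier (D n)"
  obtain m where m: "dist (y + h) m \<le> infdist m (frontier (D n))" "dist (y - h) m \<le> infdist m (frontier (D n))"
    using exists_center[OF assms(1-3)] .
  define w where "w = y - m"
  have "norm (w + h) \<le> norm w" "norm (w + - h) \<le> norm w"
    using m infdist_le[OF y, of m] by (auto simp: w_def dist_norm norm_minus_commute algebra_simps)
  then have "(norm (w + h))\<^sup>2 \<le> (norm w)\<^sup>2" "(norm (w + - h))\<^sup>2 \<le> (norm w)\<^sup>2" by (auto intro: power_mono)
  then have "(norm h)\<^sup>2 \<le> 0"
    unfolding norm_power2_add inner_minus_right norm_minus_cancel by linarith
  then show False using assms(4) by simp
qed

lemma midpoint_notin_limit:
  assumes "A = 1" "y + h \<in> U" "y - h \<in> U" "h \<noteq> 0"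
  shows "y \<notin> Y"
proof
  assume y: "y \<in> Y"
  obtain K0 where K0: "compact K0" "connected K0" "K0 \<subseteq> U" "y + h \<in> K0" "y - h \<in> K0" "z0 \<in> K0"
    using compact_connected_in_U[OF assms(2,3)] .
  obtain \<rho>1 where \<rho>1: "0 < \<rho>1" "cball (y + h) \<rho>1 \<subseteq> U"
    using open_U assms(2) open_contains_cball by blast
  obtain \<rho>2 where \<rho>2: "0 < \<rho>2" "cball (y - h) \<rho>2 \<subseteq> U"
    using open_U assms(3) open_contains_cball by blast
  \<comment> \<open>The discs leave room to translate: a boundary point \<open>w\<close> of
    \<open>D n\<close> close to \<open>y\<close> still has \<open>w + h\<close> and
    \<open>w - h\<close> in \<open>D n\<close>.\<close>
  define K where "K = (K0 \<union> cball (y + h) \<rho>1) \<union> cball (y - h) \<rho>2"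
  have "connected K"
    unfolding K_def using K0 \<rho>1(1) \<rho>2(1)
    by (intro connected_Un connected_cball) (auto intro!: disjointI simp: disjoint_iff)
  then have freq: "\<exists>\<^sub>F n in sequentially. K \<subseteq> D n"
    using K0 \<rho>1 \<rho>2 by (intro frequently_subset_D) (auto simp: K_def intro!: compact_Un)
  have "\<forall>\<^sub>F n in sequentially. infdist y (frontier (D n)) < min \<rho>1 \<rho>2"
    using order_tendstoD(2)[OF conv[of y], of "min \<rho>1 \<rho>2"] \<rho>1(1) \<rho>2(1) y by simp
  from frequently_ex[OF frequently_eventually_conj[OF freq this]]
  obtain n where n: "K \<subseteq> D n" "infdist y (frontier (D n)) < min \<rho>1 \<rho>2" by blast
  have "frontier (D n) \<noteq> {}" using zero_frontier[of n] by auto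
  then obtain w where w: "w \<in> frontier (D n)" "dist y w < min \<rho>1 \<rho>2"
    using infdist_attains_inf[OF frontier_closed, of "D n" y] n(2) by metis
  moreover have "dist (y + h) (w + h) = dist y w" "dist (y - h) (w - h) = dist y w"
    by (simp_all add: dist_norm)
  ultimately have "w + h \<in> cball (y + h) \<rho>1" "w - h \<in> cball (y - h) \<rho>2" by auto
  then show False using midpoint_notin_frontier[OF assms(1) _ _ assms(4), of w n] w(1) n(1)
    unfolding K_def by blast
qed

text \<open>For \<open>A = 1\<close> the approximating domains contain discs through \<open>a\<close> and \<open>b\<close>. If the radii of these are
  unbounded, then \<open>U\<close> contains a half-plane with \<open>a\<close> and \<open>b\<close> in its closure, and by convexity
  (\<open>midpoint_notin_limit\<close>) \<open>Y\<close> does not touch its boundary line on the level of \<open>b\<close>.\<close>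

lemma carrot_sets_meet_if_eq_1:
  assumes A1: "A = 1" and ab: "a \<in> U" "b \<in> U"
  shows "carrot_set A Y a \<inter> carrot_set A Y b \<noteq> {}"
proof (rule ccontr)
  assume "\<not> ?thesis"
  then have none: "\<not> (dist a m \<le> infdist m Y \<and> dist b m \<le> infdist m Y)" for m
    using carrot_set_of_dist_le A1 by blast
  obtain K where K: "compact K" "connected K" "K \<subseteq> U" "a \<in> K" "b \<in> K" "z0 \<in> K"
    using compact_connected_in_U[OF ab] .
  \<comment> \<open>Centres that stay bounded would accumulate at a centre for \<open>Y\<close>,
    contrary to \<open>none\<close>; hence they escape to infinity.\<close>
  have "\<exists>n\<ge>j. \<exists>m. real j \<le> norm m \<and> dist a m \<le> infdist m (frontier (D n)) \<and> dist b m \<le> infdist m (frontier (D n))"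
    for j :: nat
  proof -
    have "\<forall>\<^sub>F n in sequentially. \<forall>m\<in>cball 0 (real j).
        dist a m \<le> infdist m (frontier (D n)) \<and> dist b m \<le> infdist m (frontier (D n)) \<longrightarrow> m \<in> {}"
    proof (rule eventually_on_compact[OF compact_cball open_empty])
      fix k P p assume k: "strict_mono (k :: nat \<Rightarrow> nat)" "P \<longlonglongrightarrow> p"
        and le: "\<And>i. dist a (P i) \<le> infdist (P i) (frontier (D (k i))) \<and> dist b (P i) \<le> infdist (P i) (frontier (D (k i)))"
      have lim: "(\<lambda>i. infdist (P i) (frontier (D (k i)))) \<longlonglongrightarrow> infdist p Y"
        by (rule infdist_tendsto_moving[OF conv_subseq[OF k(1)] k(2)])
      have "dist a p \<le> infdist p Y" "dist b p \<le> infdist p Y"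
        using LIMSEQ_le[OF tendsto_dist[OF tendsto_const k(2)] lim] le by auto
      then show "p \<in> {}" using none by blast
    qed
    moreover have "\<forall>\<^sub>F n in sequentially. j \<le> n" by (rule eventually_ge_at_top)
    ultimately have "\<forall>\<^sub>F n in sequentially. j \<le> n \<and> (\<forall>m\<in>cball 0 (real j).
        \<not> (dist a m \<le> infdist m (frontier (D n)) \<and> dist b m \<le> infdist m (frontier (D n))))"
      by eventually_elim auto
    from frequently_ex[OF frequently_eventually_conj[OF frequently_subset_D[OF K(1-3,6)] this]]
    obtain n where n: "K \<subseteq> D n" "j \<le> n" "\<And>m. m \<in> cball 0 (real j) \<Longrightarrow>
        \<not> (dist a m \<le> infdist m (frontier (D n)) \<and> dist b m \<le> infdist m (frontier (D n)))" by blast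
    obtain m where m: "dist a m \<le> infdist m (frontier (D n))" "dist b m \<le> infdist m (frontier (D n))"
      using exists_center[OF A1, of a n b] K n(1) by blast
    then have "m \<notin> cball 0 (real j)" using n(3) by blast
    then show ?thesis using n(2) m by (intro exI[of _ n] conjI exI[of _ m]) auto
  qed
  then obtain N m where N: "\<And>j. j \<le> N j" and m: "\<And>j. real j \<le> norm (m j)"
    "\<And>j. dist a (m j) \<le> infdist (m j) (frontier (D (N j)))" "\<And>j. dist b (m j) \<le> infdist (m j) (frontier (D (N j)))"
    by metis
  \<comment> \<open>The shift to \<open>Suc j\<close> excludes a centre at 0.\<close>
  have sph: "m (Suc j) /\<^sub>R norm (m (Suc j)) \<in> sphere 0 1" for j
  proof -
    have "0 < norm (m (Suc j))" by (rule less_le_trans[OF _ m(1)]) simp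
    then show ?thesis by simp
  qed
  obtain e k where e: "e \<in> sphere 0 1" and k: "strict_mono (k :: nat \<Rightarrow> nat)"
    and lim: "(\<lambda>j. m (Suc (k j)) /\<^sub>R norm (m (Suc (k j)))) \<longlonglongrightarrow> e"
    by (rule convergent_subsequence[OF compact_sphere sph])
  have kj: "j \<le> k j" for j using seq_suble[OF k] .
  have top: "filterlim (\<lambda>j. norm (m (Suc (k j)))) at_top sequentially"
    by (rule filterlim_at_top_mono[OF filterlim_real_sequentially], intro always_eventually allI)
      (use m(1) kj in \<open>meson le_SucI of_nat_mono order_trans\<close>)
  have topN: "filterlim (\<lambda>j. N (Suc (k j))) at_top sequentially"
    by (rule filterlim_at_top_mono[OF filterlim_ident], intro always_eventually allI)
      (use N kj in \<open>meson le_SucI order_trans\<close>)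
  have Y_below: "y \<bullet> e \<le> a \<bullet> e" "y \<bullet> e \<le> b \<bullet> e" if y: "y \<in> Y" for y
  proof -
    have "\<exists>w. w \<in> frontier (D n) \<and> infdist y (frontier (D n)) = dist y w" for n
      using infdist_attains_inf[OF frontier_closed, of "D n" y] zero_frontier[of n] by blast
    then obtain w where w: "\<And>n. w n \<in> frontier (D n)" "\<And>n. infdist y (frontier (D n)) = dist y (w n)" by metis
    have "(\<lambda>n. dist (w n) y) \<longlonglongrightarrow> 0" using conv[of y] y w(2) by (simp add: dist_commute)
    then have "w \<longlonglongrightarrow> y" by (rule tendsto_dist_iff[THEN iffD2])
    then have w_lim: "(\<lambda>j. w (N (Suc (k j)))) \<longlonglongrightarrow> y" by (rule filterlim_compose[OF _ topN])
    have "dist c (m (Suc (k j))) \<le> dist (m (Suc (k j))) (w (N (Suc (k j))))"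
      if "c = a \<or> c = b" for c j
      using that m(2,3)[of "Suc (k j)"] infdist_le[OF w(1)[of "N (Suc (k j))"], of "m (Suc (k j))"] by auto
    then show "y \<bullet> e \<le> a \<bullet> e" "y \<bullet> e \<le> b \<bullet> e"
      by (auto intro!: horofunction_limit[OF _ w_lim top lim])
  qed
  have ee: "e \<bullet> e = 1" using e by (simp add: norm_eq_1)
  have strict: "y \<bullet> e < b \<bullet> e" if y: "y \<in> Y" for y
  proof (rule ccontr)
    assume "\<not> y \<bullet> e < b \<bullet> e"
    then have eq: "y \<bullet> e = b \<bullet> e" using Y_below[OF y] by simp
    obtain \<kappa> where \<kappa>: "0 < \<kappa>" "cball b \<kappa> \<subseteq> U" using open_U ab(2) open_contains_cball by blast
    \<comment> \<open>If \<open>Y\<close> touched the line at \<open>y\<close>, then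
      \<open>y\<close> would be the midpoint of \<open>b - \<kappa> *\<^sub>R e\<close>, close to
      \<open>b\<close>, and a point at height \<open>\<kappa>\<close> beyond the line, reached from
      \<open>b\<close> inside \<open>U\<close>.\<close>
    define h where "h = (y - b) + \<kappa> *\<^sub>R e"
    have "y - h = b - \<kappa> *\<^sub>R e" by (simp add: h_def)
    moreover have "b - \<kappa> *\<^sub>R e \<in> cball b \<kappa>" using \<kappa>(1) e by (simp add: dist_norm)
    ultimately have 1: "y - h \<in> U" using \<kappa>(2) by auto
    have he: "h \<bullet> e = \<kappa>" using eq ee by (simp add: h_def inner_simps)
    have "closed_segment b (y + h) \<subseteq> U"
    proof (rule U_connected_extend)
      have "z \<notin> Y" if z: "z \<in> closed_segment b (y + h)" for z
      proof -
        obtain u where u: "z = (1 - u) *\<^sub>R b + u *\<^sub>R (y + h)" "0 \<le> u" "u \<le> 1"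
          using z by (auto simp: in_segment)
        have "z \<bullet> e = b \<bullet> e + u * \<kappa>" using eq he by (simp add: u(1) inner_simps algebra_simps)
        then have "u = 0" if "z \<in> Y" using Y_below(2)[OF that] u(2) \<kappa>(1) by (simp add: mult_le_0_iff)
        then show ?thesis using u(1) ab(2) U_subset by auto
      qed
      then show "closed_segment b (y + h) \<inter> Y = {}" by blast
      show "closed_segment b (y + h) \<inter> U \<noteq> {}" using ab(2) by auto
    qed auto
    then have "y + h \<in> U" by auto
    moreover have "h \<noteq> 0" using he \<kappa>(1) by auto
    ultimately show False using midpoint_notin_limit[OF A1 _ 1] y by blast
  qed
  \<comment> \<open>Only points of \<open>Y\<close> no farther from \<open>a\<close> than
    \<open>b\<close> can lie closer to the new centre than \<open>b\<close>; on this compact set the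
    strict inequality has a uniform gap \<open>\<delta>\<close>.\<close>
  define Q where "Q = Y \<inter> cball a (dist a b)"
  have "compact Q" by (simp add: Q_def closed_Y closed_Int_compact)
  have "\<exists>\<delta>>0. \<forall>y\<in>Q. \<delta> \<le> (b - y) \<bullet> e"
  proof (cases "Q = {}")
    case True
    then show ?thesis by (intro exI[of _ 1]) auto
  next
    case False
    have "continuous_on Q (\<lambda>y. (b - y) \<bullet> e)" by (intro continuous_intros)
    from continuous_attains_inf[OF \<open>compact Q\<close> False this]
    obtain y0 where "y0 \<in> Q" "\<forall>y\<in>Q. (b - y0) \<bullet> e \<le> (b - y) \<bullet> e" by blast
    then show ?thesis using strict[of y0]
      by (intro exI[of _ "(b - y0) \<bullet> e"]) (auto simp: Q_def inner_diff_left)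
  qed
  then obtain \<delta> where \<delta>: "0 < \<delta>" "\<And>y. y \<in> Q \<Longrightarrow> \<delta> \<le> (b - y) \<bullet> e" by blast
  \<comment> \<open>For \<open>c = a + M *\<^sub>R e\<close>, the squared distance from
    \<open>c\<close> to \<open>y\<close> minus that to \<open>b\<close> is \<open>2 * (M * ((b - y)
    \<bullet> e)) + (dist a y)\<^sup>2 - (dist a b)\<^sup>2\<close>; this \<open>M\<close> makes the
    gap \<open>\<delta>\<close> compensate the last term.\<close>
  define M where "M = (dist a b)\<^sup>2 / (2 * \<delta>)"
  have M: "0 \<le> M" "2 * (M * \<delta>) = (dist a b)\<^sup>2" using \<delta>(1) by (auto simp: M_def)
  define c where "c = a + M *\<^sub>R e"
  have dist_c: "(dist x c)\<^sup>2 = M\<^sup>2 + 2 * (M * ((a - x) \<bullet> e)) + (dist a x)\<^sup>2" for x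
  proof -
    have "dist x c = norm (M *\<^sub>R e + (a - x))" by (simp add: c_def dist_norm norm_minus_commute algebra_simps)
    then show ?thesis using e by (simp add: norm_power2_add dist_norm inner_commute power_mult_distrib)
  qed
  have "dist a c \<le> dist c y \<and> dist b c \<le> dist c y" if y: "y \<in> Y" for y
  proof
    have "0 \<le> M * ((a - y) \<bullet> e)" using M(1) Y_below(1)[OF y] by (simp add: inner_diff_left)
    then have "(dist a c)\<^sup>2 \<le> (dist y c)\<^sup>2" unfolding dist_c by simp
    from power2_le_imp_le[OF this zero_le_dist] show "dist a c \<le> dist c y" by (simp add: dist_commute)
    have "0 \<le> 2 * (M * ((b - y) \<bullet> e)) + (dist a y)\<^sup>2 - (dist a b)\<^sup>2"
    proof (cases "dist a y \<le> dist a b")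
      case True
      then have "M * \<delta> \<le> M * ((b - y) \<bullet> e)" using \<delta>(2)[of y] y M(1) by (intro mult_left_mono) (auto simp: Q_def)
      then show ?thesis using M(2) zero_le_power2[of "dist a y"] by linarith
    next
      case False
      then have "(dist a b)\<^sup>2 \<le> (dist a y)\<^sup>2" by (intro power_mono) auto
      moreover have "0 \<le> M * ((b - y) \<bullet> e)" using M(1) Y_below(2)[OF y] by (simp add: inner_diff_left)
      ultimately show ?thesis by linarith
    qed
    then have "(dist b c)\<^sup>2 \<le> (dist y c)\<^sup>2" unfolding dist_c by (simp add: inner_diff_left algebra_simps)
    from power2_le_imp_le[OF this zero_le_dist] show "dist b c \<le> dist c y" by (simp add: dist_commute)
  qed
  moreover have "Y \<noteq> {}" using zero_Y by auto
  ultimately have "dist a c \<le> infdist c Y" "dist b c \<le> infdist c Y"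
    by (simp_all add: infdist_notempty cINF_greatest)
  then show False using none by blast
qed

end

section \<open>Application to the rescalings of a John domain\<close>

theorem proposition3p1:
  fixes D Y U :: "complex set" and A :: real
    and p :: "nat \<Rightarrow> complex" and l :: "nat \<Rightarrow> real"
  assumes "domain D" and "simply_connected D"
    and "1 \<le> A" and "John_domain A D"
    and "weak_tangent_along (frontier D) p l Y"
    and "D_component D p l Y U"
  shows "John_domain A U"
proof -
  have wt: "closed Y" "\<And>n. p n \<in> frontier D" "\<And>n. 0 < l n"
      "local_Hausdorff_conv (\<lambda>n. rescale (p n) (l n) (frontier D)) Y"
    using assms(5) by (auto simp: weak_tangent_along_def)
  have fr: "frontier (rescale (p n) (l n) D) = rescale (p n) (l n) (frontier D)" for n
    by (rule frontier_rescale[OF wt(3)])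
  have zero: "0 \<in> rescale (p n) (l n) (frontier D)" for n
    unfolding rescale_def by (rule image_eqI[of _ _ "p n"]) (use wt(2) in auto)
  have U: "U \<in> components (- Y)" using assms(6) by (simp add: D_component_def)
  obtain z0 where z0: "z0 \<in> U" "\<exists>\<^sub>\<infinity>n. z0 \<in> rescale (p n) (l n) D"
    using assms(6) by (auto simp: D_component_def)
  interpret converging_domains A "\<lambda>n. rescale (p n) (l n) D" Y U z0
  proof
    show "open (rescale (p n) (l n) D)" for n
      using assms(1) wt(3) by (simp add: domain_def open_rescale)
    show "simply_connected (rescale (p n) (l n) D)" for n
      using homeomorphic_simply_connected[OF homeomorphic_rescale[OF wt(3)] assms(2)] .
    show "0 \<in> frontier (rescale (p n) (l n) D)" for n unfolding fr by (rule zero)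
    show "0 \<in> Y" by (rule local_Hausdorff_conv_infdist(1)[OF wt(4) zero])
    show "(\<lambda>n. infdist z (frontier (rescale (p n) (l n) D))) \<longlonglongrightarrow> infdist z Y" for z
      unfolding fr by (rule local_Hausdorff_conv_infdist(2)[OF wt(4) zero])
    show "\<exists>\<^sub>F n in sequentially. z0 \<in> rescale (p n) (l n) D" using z0(2) by (simp add: cofinite_eq_sequentially)
    fix n a b assume ab: "a \<in> rescale (p n) (l n) D" "b \<in> rescale (p n) (l n) D"
    have "frontier D \<noteq> {}" using wt(2) by auto
    from John_domain_carrots_rescale[OF assms(4) wt(3) this ab]
    show "\<exists>Sa Sb m. compact Sa \<and> connected Sa \<and> compact Sb \<and> connected Sb \<and>
        Sa \<subseteq> rescale (p n) (l n) D \<and> Sb \<subseteq> rescale (p n) (l n) D \<and> a \<in> Sa \<and> b \<in> Sb \<and> m \<in> Sa \<and> m \<in> Sb \<and>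
        Sa \<subseteq> carrot_set A (frontier (rescale (p n) (l n) D)) a \<and>
        Sb \<subseteq> carrot_set A (frontier (rescale (p n) (l n) D)) b"
      unfolding fr by metis
  qed (rule assms(3) wt(1) U z0(1))+
  show ?thesis
  proof (rule John_domain_of_carrots[OF wt(1) _ U assms(3)])
    show "Y \<noteq> {}" using zero_Y by auto
    show "carrot_set A Y a \<inter> carrot_set A Y b \<noteq> {}" if "a \<in> U" "b \<in> U" for a b
      using carrot_sets_meet_if_gt_1[OF _ that] carrot_sets_meet_if_eq_1[OF _ that] assms(3) by linarith
  qed
qed

end
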